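(* For each positive integer $n$, let $\pi_n \in \mathfrak{S}_n$ be a uniformly random permutation. Let $\operatorname{des} \colon \mathfrak{S}_n \to \mathbb{N}$ denote the function that counts the descents of a permutation, and let $s \colon \mathfrak{S}_n \to \mathfrak{S}_n$ denote West's stack-sorting map. Then $$\frac{\operatorname{des}(s(\pi_n)) + 1 - (3 - e) n}{\sqrt{n}}$$ converges in distribution, as $n \to \infty$, to $Z \sim \mathcal{N}(0, 2 + 2e - e^2)$.
   Context: $\mathfrak{S}_n$ is the set of permutations of $\{1, \ldots, n\}$, written as words $\pi = \pi(1)\pi(2)\cdots\pi(n)$ in one-line notation. A descent of $\pi$ is an index $i \in \{1, \ldots, n-1\}$ with $\pi(i) > \pi(i+1)$; $\operatorname{des}(\pi)$ is the number of descents. West's stack-sorting map $s$ is defined recursively on finite words with distinct integer letters: $s$ sends the empty word to itself, and if $w$ is a nonempty word with largest letter $m$, written $w = L\, m\, R$ with $L$ and $R$ the subwords to the left and right of $m$, then $s(w) = s(L)\, s(R)\, m$ (concatenation). It restricts to a map $\mathfrak{S}_n \to \mathfrak{S}_n$. Here $e$ is the base of the natural logarithm, and $\mathcal{N}(0, v)$ denotes the normal distribution on $\mathbb{R}$ with mean $0$ and variance $v$. *)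

theory Defs
  imports "HOL-Probability.Probability" "HOL-Combinatorics.Multiset_Permutations"
begin

text \<open>
  A permutation of \<open>{1, \<dots>, n}\<close> is its one-line word \<open>\<pi>(1) \<dots> \<pi>(n)\<close>, i.e. an element of
  \<^term>\<open>permutations_of_set {1..n}\<close>. Lists are indexed from 0, so \<open>\<pi>(i)\<close> is \<open>\<pi> ! (i - 1)\<close>.
\<close>

definition des :: "'a::linorder list \<Rightarrow> nat" where
  "des \<pi> = card {i \<in> {1..<length \<pi>}. \<pi> ! (i - 1) > \<pi> ! i}"

text \<open>
  For \<open>w = L m R\<close> with distinct letters and largest letter \<open>m\<close>, \<open>L\<close> is the longest prefix avoiding
  \<open>m\<close>, and \<open>R\<close> is what is left after also dropping \<open>m\<close> itself; see \<open>stack_sort_append\<close> below.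
  (For words with repeated letters the split is at the first largest letter.)
\<close>

function stack_sort :: "'a::linorder list \<Rightarrow> 'a list" where
  "stack_sort w =
     (if w = [] then []
      else let m = Max (set w);
               L = takeWhile (\<lambda>x. x \<noteq> m) w;
               R = tl (dropWhile (\<lambda>x. x \<noteq> m) w)
           in stack_sort L @ stack_sort R @ [m])"
  by auto
termination
proof (relation "Wellfounded.measure length", goal_cases)
  case 1
  show ?case by simp
next
  case (2 w m L)
  have "m \<in> set w" using 2 by simp
  then have "dropWhile (\<lambda>x. x \<noteq> m) w \<noteq> []" by (auto simp: dropWhile_eq_Nil_conv)
  then have "length (dropWhile (\<lambda>x. x \<noteq> m) w) > 0" by blast
  moreover have "length L + length (dropWhile (\<lambda>x. x \<noteq> m) w) = length w"
    unfolding 2(3) length_append[symmetric] takeWhile_dropWhile_id ..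
  ultimately show ?case unfolding in_measure by linarith
next
  case (3 w m L R)
  have "length R \<le> length w - 1"
    unfolding 3(4) length_tl by (rule diff_le_mono) (rule length_dropWhile_le)
  moreover have "length w > 0" using 3(1) by blast
  ultimately show ?case unfolding in_measure by linarith
qed

declare stack_sort.simps [simp del]

lemma stack_sort_Nil [simp]: "stack_sort [] = []"
  by (subst stack_sort.simps) simp

lemma stack_sort_append:
  assumes "\<And>x. x \<in> set L \<Longrightarrow> x < m" and "\<And>x. x \<in> set R \<Longrightarrow> x < m"
  shows "stack_sort (L @ m # R) = stack_sort L @ stack_sort R @ [m]"
proof -
  have M: "Max (set (L @ m # R)) = m"
    by (rule Max_eqI) (use assms in \<open>auto intro: less_imp_le\<close>)
  have T: "takeWhile (\<lambda>x. x \<noteq> m) (L @ m # R) = L"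
    using assms(1) by (subst takeWhile_append2) auto
  have D: "dropWhile (\<lambda>x. x \<noteq> m) (L @ m # R) = m # R"
    using assms(1) by (subst dropWhile_append2) auto
  show ?thesis
    by (subst stack_sort.simps) (simp only: M T D Let_def, simp)
qed

lemma mset_stack_sort: "mset (stack_sort w) = mset w"
proof (induction w rule: stack_sort.induct)
  case (1 w)
  show ?case
  proof (cases "w = []")
    case False
    define m where "m = Max (set w)"
    define L where "L = takeWhile (\<lambda>x. x \<noteq> m) w"
    define R where "R = tl (dropWhile (\<lambda>x. x \<noteq> m) w)"
    have "m \<in> set w" using False by (simp add: m_def)
    then have ne: "dropWhile (\<lambda>x. x \<noteq> m) w \<noteq> []" by (auto simp: dropWhile_eq_Nil_conv)
    moreover have "hd (dropWhile (\<lambda>x. x \<noteq> m) w) = m"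
      using hd_dropWhile[OF ne] by blast
    ultimately have D: "dropWhile (\<lambda>x. x \<noteq> m) w = m # R"
      unfolding R_def by (cases "dropWhile (\<lambda>x. x \<noteq> m) w") simp_all
    have w: "w = L @ m # R"
      unfolding L_def D[symmetric] by (rule takeWhile_dropWhile_id[symmetric])
    have "mset (stack_sort w) = mset (stack_sort L @ stack_sort R @ [m])"
      by (subst stack_sort.simps) (simp add: False Let_def L_def R_def m_def)
    also have "\<dots> = mset (L @ m # R)"
      using 1[OF False m_def L_def R_def] 1(1)[OF False m_def L_def] by simp
    finally show ?thesis using w by simp
  qed simp
qed

lemma stack_sort_in_permutations_of_set:
  assumes "w \<in> permutations_of_set A"
  shows "stack_sort w \<in> permutations_of_set A"
  using assms mset_eq_setD[OF mset_stack_sort[of w]]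
    mset_eq_imp_distinct_iff[OF mset_stack_sort[of w]]
  by (simp add: permutations_of_set_def)

end

theory Submission
  imports Defs "HOL-Complex_Analysis.Complex_Analysis"
begin

text \<open>
  Write \<open>c = 1 - y\<close>, let \<open>A\<close> be the exponential generating function of the nonempty words, each
  weighted by \<open>y\<close> to the number of descents of its sorted word, and let \<open>G(v, a)\<close> be the density,
  for letters uniform below \<open>v\<close>, of the words \<open>w\<close> whose sorted word \<open>s(w)\<close> starts with the letter \<open>a\<close>.
  Splitting at the largest letter creates a descent between \<open>s(L)\<close> and \<open>s(R)\<close> unless all of \<open>L\<close> lies
  below the first letter of \<open>s(R)\<close>, so that
  \<open>\<partial>G/\<partial>v = (2 + y A(v)) G + c (G \<circ> G)\<close>, where \<open>\<circ>\<close> is composition of kernels. The substitution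
  \<open>G(v, a) = k(v, a) E(a) / E(v)\<close> with \<open>E' = - y (1 + A) E\<close> removes \<open>A\<close> and leaves
  \<open>\<partial>k/\<partial>v = (1 + c) k + c (k \<circ> k)\<close>, whose solution depends on \<open>v - a\<close> only and is an exponential
  generating function of Motzkin paths. This makes \<open>E\<close> explicit and entire, with \<open>E = 1 - x\<close> for
  \<open>y = 1\<close>. The coefficients of \<open>- E' / E = y (1 + A)\<close> are the expectations of \<open>y\<close> to the power
  \<open>des (s \<pi>) + 1\<close>, and they are governed by the zero \<open>\<rho>\<close> of \<open>E\<close> near \<open>1\<close>. A second-order
  expansion of \<open>\<rho>\<close> at \<open>y = 1\<close> gives the limit of the characteristic functions.
\<close>

subsection \<open>Descents of stack-sorted words\<close>

lemma des_append:
  assumes "xs \<noteq> []" "ys \<noteq> []"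
  shows "des (xs @ ys) = des xs + des ys + (if last xs > hd ys then 1 else 0)"
proof -
  let ?n = "length xs" and ?D = "\<lambda>zs. {i \<in> {1..<length zs}. zs ! (i - 1) > zs ! i}"
  have "?D (xs @ ys) = ?D xs \<union> (+) ?n ` ?D ys \<union> (if last xs > hd ys then {?n} else {})"
    (is "?l = ?r")
  proof (intro set_eqI iffI)
    fix i assume i: "i \<in> ?l"
    consider "i < ?n" | "i = ?n" | j where "i = ?n + j" "j > 0"
      by (metis add_eq_0_iff_both_eq_0 gr0I le_Suc_ex less_or_eq_imp_le linorder_neqE_nat nat_less_le add.right_neutral)
    then show "i \<in> ?r"
    proof cases
      case 3
      moreover have "(xs @ ys) ! (i - 1) = ys ! (j - 1)"
        using 3 by (subst nth_append_right) auto
      ultimately have "j \<in> ?D ys" using i by auto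
      then show ?thesis using 3 by blast
    qed (use i assms in \<open>auto simp: nth_append last_conv_nth hd_conv_nth split: if_splits\<close>)
  next
    fix i assume "i \<in> ?r"
    then consider "i \<in> ?D xs" | j where "i = ?n + j" "j \<in> ?D ys" | "i = ?n" "last xs > hd ys"
      by (auto split: if_splits)
    then show "i \<in> ?l"
    proof cases
      case (2 j)
      moreover have "(xs @ ys) ! (i - 1) = ys ! (j - 1)"
        using 2 by (subst nth_append_right) auto
      ultimately show ?thesis by auto
    qed (use assms in \<open>auto simp: nth_append last_conv_nth hd_conv_nth Suc_le_eq\<close>)
  qed
  moreover have "card ?r = des xs + des ys + (if last xs > hd ys then 1 else 0)"
    unfolding des_def
    by (subst card_Un_disjoint; (subst card_Un_disjoint)?) (auto simp: card_image)
  ultimately show ?thesis unfolding des_def by simp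
qed

lemma des_Nil [simp]: "des [] = 0" and des_single [simp]: "des [x] = 0"
  by (simp_all add: des_def)

lemma set_stack_sort [simp]: "set (stack_sort w) = set w"
  using mset_eq_setD[OF mset_stack_sort] .

lemma stack_sort_eq_Nil_iff [simp]: "stack_sort w = [] \<longleftrightarrow> w = []"
  using set_stack_sort[of w] by (metis set_empty)

lemma last_stack_sort: "w \<noteq> [] \<Longrightarrow> last (stack_sort w) = Max (set w)"
  by (subst stack_sort.simps) (simp add: Let_def)

lemma hd_stack_sort_in: "w \<noteq> [] \<Longrightarrow> hd (stack_sort w) \<in> set w"
  using list.set_sel(1)[of "stack_sort w"] by simp

context
  fixes L R :: "'a::linorder list" and m :: 'a
  assumes L: "\<And>x. x \<in> set L \<Longrightarrow> x < m" and R: "\<And>x. x \<in> set R \<Longrightarrow> x < m"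
begin

lemma hd_stack_sort_append:
  "hd (stack_sort (L @ m # R)) =
     (if L \<noteq> [] then hd (stack_sort L) else if R \<noteq> [] then hd (stack_sort R) else m)"
  by (simp add: stack_sort_append[OF L R] hd_append)

text \<open>A sorted word ends in its largest letter. Hence appending \<open>m\<close> adds no
  descent, and the junction of \<open>stack_sort L\<close> and \<open>stack_sort R\<close> is a
  descent exactly when \<open>Max (set L)\<close> exceeds the first letter of
  \<open>stack_sort R\<close>.\<close>

lemma des_stack_sort_append:
  "des (stack_sort (L @ m # R)) = des (stack_sort L) + des (stack_sort R) +
     (if L \<noteq> [] \<and> R \<noteq> [] \<and> Max (set L) > hd (stack_sort R) then 1 else 0)"
proof -
  have *: "des (stack_sort w @ [m]) = des (stack_sort w)" if "\<And>x. x \<in> set w \<Longrightarrow> x < m" for w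
  proof (cases "w = []")
    case False
    then have "Max (set w) < m" by (intro that Max_in) auto
    then have "\<not> Max (set w) > m" by simp
    then show ?thesis using False by (simp add: des_append last_stack_sort del: Max_less_iff)
  qed simp
  have "hd (stack_sort R @ [m]) = (if R = [] then m else hd (stack_sort R))" by simp
  moreover have "L \<noteq> [] \<Longrightarrow> Max (set L) < m" using L by simp
  moreover have "stack_sort (L @ m # R) = stack_sort L @ stack_sort R @ [m]"
    by (rule stack_sort_append[OF L R])
  ultimately show ?thesis
    by (cases "L = []") (auto simp: des_append last_stack_sort *[OF R] *[OF L] simp del: Max_less_iff)
qed

end

text \<open>
  The letters of \<open>X\<close> that \<open>w\<close> does not use lie below the first letter of \<open>s(w)\<close>; thus the operator
  \<open>\<phi> \<mapsto> word_sum y \<phi>\<close> is the discrete form of integration against the kernel \<open>G\<close>.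
\<close>

definition words :: "'a::linorder set \<Rightarrow> 'a list set" where
  "words X = {w. distinct w \<and> set w \<subseteq> X \<and> w \<noteq> [] \<and> (\<forall>x\<in>X - set w. x < hd (stack_sort w))}"

definition word_sum :: "'b::comm_ring_1 \<Rightarrow> ('a::linorder set \<Rightarrow> 'b) \<Rightarrow> 'a set \<Rightarrow> 'b" where
  "word_sum y \<phi> X = (\<Sum>w\<in>words X. y ^ des (stack_sort w) * \<phi> (X - set w))"

lemma finite_words [simp]:
  assumes "finite X"
  shows "finite (words X)"
  by (rule finite_subset[OF _ finite_subset_distinct[OF assms]]) (auto simp: words_def)

lemma words_empty [simp]: "words {} = {}"
  by (auto simp: words_def)

lemma word_sum_empty [simp]: "word_sum y \<phi> {} = 0"
  by (simp add: word_sum_def)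

lemma word_sum_cong:
  "(\<And>Y. Y \<subseteq> X \<Longrightarrow> \<phi> Y = \<psi> Y) \<Longrightarrow> word_sum y \<phi> X = word_sum y \<psi> X"
  unfolding word_sum_def by (intro sum.cong) auto

text \<open>The function \<open>\<phi>\<close> supported at \<open>{}\<close> corresponds to the power series \<open>1\<close>.\<close>

lemma word_sum_delta:
  assumes "finite X"
  shows "word_sum y (\<lambda>Y. if Y = {} then 1 else 0) X =
    (if X = {} then 0 else \<Sum>w\<in>permutations_of_set X. y ^ des (stack_sort w))"
proof (cases "X = {}")
  case False
  have "word_sum y (\<lambda>Y. if Y = {} then 1 else 0) X =
    (\<Sum>w\<in>{w \<in> words X. set w = X}. y ^ des (stack_sort w))"
    unfolding word_sum_def using finite_words[OF assms]
    by (intro sum.mono_neutral_cong_right) (auto simp: words_def)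
  also have "{w \<in> words X. set w = X} = permutations_of_set X"
    using False by (auto simp: words_def permutations_of_set_def)
  finally show ?thesis using False by simp
qed simp

text \<open>The letter \<open>m\<close> must occur in \<open>w\<close>: otherwise it would lie below
  the first letter of \<open>stack_sort w\<close>, which belongs to \<open>X\<close>. That first
  letter comes from \<open>L\<close> unless \<open>L\<close> is empty, so in the last case
  \<open>R\<close> is arbitrary and only \<open>L\<close> carries a condition, relative to the
  letters that \<open>R\<close> leaves.\<close>

lemma words_Max_cases:
  assumes "finite X" "X \<noteq> {}"
  defines "m \<equiv> Max X"
  defines "Z \<equiv> X - {m}"
  shows "words X = {[m]} \<union> (#) m ` words Z \<union> (\<lambda>L. L @ [m]) ` words Z \<union>
    (\<lambda>(R, L). L @ m # R) ` (SIGMA R:{R. distinct R \<and> set R \<subseteq> Z \<and> R \<noteq> []}. words (Z - set R))"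
    (is "_ = ?r")
proof (intro set_eqI iffI)
  have mX: "m \<in> X" unfolding m_def using assms by simp
  have lt: "x < m" if "x \<in> Z" for x
    using that assms Max_ge[of X x] by (auto simp: less_le Z_def m_def)
  have X: "X = insert m Z" "m \<notin> Z" using mX by (auto simp: Z_def)
  fix w
  {
    assume w: "w \<in> words X"
    have "m \<in> set w"
    proof (rule ccontr)
      assume "m \<notin> set w"
      then have "m < hd (stack_sort w)" using w mX by (auto simp: words_def)
      moreover have "hd (stack_sort w) \<in> X" using w hd_stack_sort_in[of w] by (auto simp: words_def)
      ultimately show False using assms(1) Max_ge[of X] by (auto simp: m_def leD)
    qed
    then obtain L R where wLR: "w = L @ m # R" by (meson split_list)
    have d: "distinct L" "distinct R" "set L \<inter> set R = {}" "set L \<subseteq> Z" "set R \<subseteq> Z"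
      using w unfolding words_def wLR Z_def by auto
    have rest: "x < hd (stack_sort w)" if "x \<in> Z - set L - set R" for x
      using w that X unfolding words_def wLR by auto
    have hd: "hd (stack_sort w) =
     (if L \<noteq> [] then hd (stack_sort L) else if R \<noteq> [] then hd (stack_sort R) else m)"
      unfolding wLR by (rule hd_stack_sort_append) (use d lt in auto)
    consider "L = []" "R = []" | "L = []" "R \<noteq> []" | "L \<noteq> []" "R = []" | "L \<noteq> []" "R \<noteq> []" by blast
    then show "w \<in> ?r"
    proof cases
      case 2
      then have "R \<in> words Z" using d rest hd by (auto simp: words_def)
      then show ?thesis using wLR 2 by auto
    next
      case 3
      then have "L \<in> words Z" using d rest hd by (auto simp: words_def)
      then show ?thesis using wLR 3 by auto
    next
      case 4
      then have "L \<in> words (Z - set R)" using d rest hd by (auto simp: words_def)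
      then show ?thesis using wLR 4 d by (intro UnI2 image_eqI[where x = "(R, L)"]) auto
    qed (use wLR in auto)
  }
  have hd: "hd (stack_sort (L @ m # R)) =
     (if L \<noteq> [] then hd (stack_sort L) else if R \<noteq> [] then hd (stack_sort R) else m)"
    if "set L \<subseteq> Z" "set R \<subseteq> Z" for L R
    by (rule hd_stack_sort_append) (use that lt in auto)
  assume "w \<in> ?r"
  then consider "w = [m]" | R where "w = m # R" "R \<in> words Z" | L where "w = L @ [m]" "L \<in> words Z"
    | L R where "w = L @ m # R" "distinct R" "set R \<subseteq> Z" "R \<noteq> []" "L \<in> words (Z - set R)"
    by auto
  then show "w \<in> words X"
  proof cases
    case 1
    then show ?thesis using hd[of "[]" "[]"] lt X by (auto simp: words_def)
  next
    case 2
    then show ?thesis using hd[of "[]" R] X by (auto simp: words_def)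
  next
    case 3
    then show ?thesis using hd[of L "[]"] X by (auto simp: words_def)
  next
    case 4
    moreover from this have "set L \<subseteq> Z" "L \<noteq> []" by (auto simp: words_def)
    ultimately show ?thesis using hd[of L R] X by (auto simp: words_def)
  qed
qed

lemma hd_stack_sort_words_le:
  assumes "w \<in> words X" "finite X" "x \<in> X"
  shows "x \<le> Max (set w)"
proof (cases "x \<in> set w")
  case False
  then have "x < hd (stack_sort w)" using assms by (auto simp: words_def)
  also have "\<dots> \<le> Max (set w)" using assms hd_stack_sort_in[of w] by (intro Max_ge) (auto simp: words_def)
  finally show ?thesis by simp
qed simp

text \<open>The terms come from the four cases of \<open>words_Max_cases\<close>, with
  \<open>\<phi> Z\<close> from the one-letter word. If both sides of the largest letter are
  nonempty, the junction has weight \<open>y\<close> at a descent and \<open>1 = y + (1 - y)\<close>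
  otherwise. The \<open>y\<close> parts range over all \<open>R\<close>; the \<open>1 - y\<close>
  parts range over \<open>R\<close> in \<open>words Z\<close>, which iterates the operator.\<close>

lemma word_sum_rec:
  fixes X :: "'a::linorder set" and y :: "'b::comm_ring_1"
  assumes X: "finite X" "X \<noteq> {}"
  defines "Z \<equiv> X - {Max X}"
  shows "word_sum y \<phi> X = \<phi> Z + 2 * word_sum y \<phi> Z
    + y * (\<Sum>Y\<in>Pow Z. word_sum y (\<lambda>Y. if Y = {} then 1 else 0) Y * word_sum y \<phi> (Z - Y))
    + (1 - y) * word_sum y (word_sum y \<phi>) Z"
proof -
  define m where "m = Max X"
  have lt: "x < m" if "x \<in> Z" for x
    using that assms Max_ge[of X x] by (auto simp: less_le Z_def m_def)
  have mX: "m \<in> X" unfolding m_def using assms by simp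
  have XZ: "X = insert m Z" "m \<notin> Z" using mX by (auto simp: Z_def m_def)
  have fZ: "finite Z" using X by (simp add: Z_def)
  define D where "D = {R. distinct R \<and> set R \<subseteq> Z \<and> R \<noteq> []}"
  have fD: "finite D" unfolding D_def by (rule finite_subset[OF _ finite_subset_distinct[OF fZ]]) blast
  define P where "P = (SIGMA R:D. words (Z - set R))"
  let ?s = "\<lambda>w. y ^ des (stack_sort w)"
  let ?g = "\<lambda>w. ?s w * \<phi> (X - set w)"
  have w: "words X = {[m]} \<union> (#) m ` words Z \<union> (\<lambda>L. L @ [m]) ` words Z \<union> (\<lambda>(R, L). L @ m # R) ` P"
    unfolding P_def D_def m_def Z_def by (rule words_Max_cases[OF X])
  have inj: "inj_on (\<lambda>(R, L). L @ m # R) P"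
  proof (rule inj_onI, clarify)
    fix R L R' L' assume *: "(R, L) \<in> P" "(R', L') \<in> P" "L @ m # R = L' @ m # R'"
    have "m \<notin> set L" "m \<notin> set R" "m \<notin> set L'" "m \<notin> set R'"
      using * XZ by (auto simp: P_def D_def words_def)
    then show "R = R' \<and> L = L'" using *(3) by (simp add: append_Cons_eq_iff)
  qed
  have nm: "m \<notin> set w" "w \<noteq> []" if "w \<in> words Z" for w using that XZ by (auto simp: words_def)
  have nmP: "R \<noteq> []" "L \<noteq> []" "m \<notin> set R" "m \<notin> set L" "set R \<subseteq> Z" "set L \<subseteq> Z" "set L \<inter> set R = {}"
    if "(R, L) \<in> P" for R L
    using that XZ by (auto simp: P_def D_def words_def)
  have fP: "finite P" unfolding P_def using fD fZ by auto
  have "word_sum y \<phi> X = (\<Sum>w\<in>{[m]}. ?g w) + (\<Sum>w\<in>(#) m ` words Z. ?g w)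
      + (\<Sum>w\<in>(\<lambda>L. L @ [m]) ` words Z. ?g w) + (\<Sum>w\<in>(\<lambda>(R, L). L @ m # R) ` P. ?g w)"
    unfolding word_sum_def w
    apply (subst sum.union_disjoint)
    subgoal using fZ by simp
    subgoal using fP by simp
    subgoal using nm nmP by (fastforce simp: append_eq_Cons_conv Cons_eq_append_conv append_eq_append_conv2)
    apply (subst sum.union_disjoint)
    subgoal using fZ by simp
    subgoal using fZ by simp
    subgoal using nm(1)[of "_ @ [m]"] nm(2)[of "[]"] by (auto simp: Cons_eq_append_conv)
    apply (subst sum.union_disjoint)
    using fZ nm by auto
  moreover have "(\<Sum>w\<in>{[m]}. ?g w) = \<phi> Z"
    using stack_sort_append[of "[]" m "[]"] by (simp add: Z_def m_def)
  moreover have "(\<Sum>w\<in>(#) m ` words Z. ?g w) = word_sum y \<phi> Z"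
  proof -
    have "?g (m # w) = ?s w * \<phi> (Z - set w)" if "w \<in> words Z" for w
    proof -
      have "des (stack_sort ([] @ m # w)) = des (stack_sort w)"
        by (subst des_stack_sort_append) (use that lt in \<open>auto simp: words_def\<close>)
      moreover have "X - set (m # w) = Z - set w" using XZ by auto
      ultimately show ?thesis by simp
    qed
    then show ?thesis unfolding word_sum_def by (subst sum.reindex) auto
  qed
  moreover have "(\<Sum>w\<in>(\<lambda>L. L @ [m]) ` words Z. ?g w) = word_sum y \<phi> Z"
  proof -
    have "?g (w @ [m]) = ?s w * \<phi> (Z - set w)" if "w \<in> words Z" for w
    proof -
      have "des (stack_sort (w @ m # [])) = des (stack_sort w)"
        by (subst des_stack_sort_append) (use that lt in \<open>auto simp: words_def\<close>)
      moreover have "X - set (w @ [m]) = Z - set w" using XZ by auto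
      ultimately show ?thesis by simp
    qed
    then show ?thesis unfolding word_sum_def by (subst sum.reindex) (auto simp: inj_on_def)
  qed
  moreover have "(\<Sum>w\<in>(\<lambda>(R, L). L @ m # R) ` P. ?g w) =
     y * (\<Sum>Y\<in>Pow Z. word_sum y (\<lambda>Y. if Y = {} then 1 else 0) Y * word_sum y \<phi> (Z - Y))
     + (1 - y) * word_sum y (word_sum y \<phi>) Z"
  proof -
    have g: "?g (L @ m # R) = y * (?s R * (?s L * \<phi> (Z - set R - set L))) +
       (1 - y) * (if R \<in> words Z then ?s R * (?s L * \<phi> (Z - set R - set L)) else 0)"
      if RL: "(R, L) \<in> P" for R L
    proof -
      note nP = nmP[OF RL]
      have L: "L \<in> words (Z - set R)" using RL by (auto simp: P_def)
      have D: "des (stack_sort (L @ m # R)) = des (stack_sort L) + des (stack_sort R) +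
        (if Max (set L) > hd (stack_sort R) then 1 else 0)"
        by (subst des_stack_sort_append) (use nP lt in auto)
      have "X - set (L @ m # R) = Z - set R - set L" using XZ by auto
      \<comment> \<open>As \<open>L\<close> lies in \<open>words (Z - set R)\<close>, its largest
        letter bounds all of \<open>Z - set R\<close>. The absence of a descent is therefore the
        defining condition of \<open>words Z\<close> for \<open>R\<close>.\<close>
      moreover have "(\<not> Max (set L) > hd (stack_sort R)) = (R \<in> words Z)"
      proof
        assume *: "R \<in> words Z"
        have "Max (set L) \<in> set L" using nP by simp
        then have "Max (set L) \<in> Z - set R" using nP(6,7) by blast
        then show "\<not> Max (set L) > hd (stack_sort R)" using * by (auto simp: words_def dest: less_asym)
      next
        assume *: "\<not> Max (set L) > hd (stack_sort R)"
        have "Max (set L) \<in> set L" using nP by simp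
        then have "Max (set L) \<noteq> hd (stack_sort R)" using nP(1,7) hd_stack_sort_in[of R]
          by (metis IntI empty_iff)
        then have "Max (set L) < hd (stack_sort R)" using * by simp
        moreover have "x \<le> Max (set L)" if "x \<in> Z - set R" for x
          using hd_stack_sort_words_le[OF L _ that] fZ by simp
        ultimately have "x < hd (stack_sort R)" if "x \<in> Z - set R" for x
          using that by (meson le_less_trans)
        then show "R \<in> words Z" using RL by (auto simp: words_def P_def D_def)
      qed
      ultimately show ?thesis unfolding D
        by (cases "R \<in> words Z") (auto simp: power_add algebra_simps)
    qed
    have "(\<Sum>w\<in>(\<lambda>(R, L). L @ m # R) ` P. ?g w) = (\<Sum>(R, L)\<in>P. ?g (L @ m # R))"
      by (subst sum.reindex[OF inj]) (simp add: case_prod_unfold)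
    also have "\<dots> = (\<Sum>(R, L)\<in>P. y * (?s R * (?s L * \<phi> (Z - set R - set L))) +
       (1 - y) * (if R \<in> words Z then ?s R * (?s L * \<phi> (Z - set R - set L)) else 0))"
      by (intro sum.cong refl) (clarsimp simp only: g split: prod.splits)
    also have "\<dots> = (\<Sum>R\<in>D. \<Sum>L\<in>words (Z - set R). y * (?s R * (?s L * \<phi> (Z - set R - set L))) +
       (1 - y) * (if R \<in> words Z then ?s R * (?s L * \<phi> (Z - set R - set L)) else 0))"
      unfolding P_def by (subst sum.Sigma) (use fD fZ in auto)
    also have "\<dots> = y * (\<Sum>R\<in>D. ?s R * word_sum y \<phi> (Z - set R))
       + (1 - y) * (\<Sum>R\<in>D. if R \<in> words Z then ?s R * word_sum y \<phi> (Z - set R) else 0)"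
      unfolding word_sum_def sum.distrib sum_distrib_left
      by (intro arg_cong2[where f = "(+)"] sum.cong refl) (auto simp: sum_distrib_left)
    also have "(\<Sum>R\<in>D. if R \<in> words Z then ?s R * word_sum y \<phi> (Z - set R) else 0)
      = word_sum y (word_sum y \<phi>) Z"
      unfolding word_sum_def[of y "word_sum y \<phi>"] using fD
      by (subst sum.inter_restrict[symmetric]) (auto simp: D_def words_def intro!: sum.cong)
    \<comment> \<open>Grouping the words \<open>R\<close> by their letter set \<open>Y\<close> turns
      the free sum into a convolution over subsets; \<open>Y = {}\<close> contributes 0 on both
      sides.\<close>
    also have "(\<Sum>R\<in>D. ?s R * word_sum y \<phi> (Z - set R))
      = (\<Sum>Y\<in>Pow Z. \<Sum>R\<in>{R\<in>D. set R = Y}. ?s R * word_sum y \<phi> (Z - set R))"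
      by (rule sum.group[symmetric]) (use fD fZ in \<open>auto simp: D_def\<close>)
    also have "\<dots> = (\<Sum>Y\<in>Pow Z. word_sum y (\<lambda>Y. if Y = {} then 1 else 0) Y * word_sum y \<phi> (Z - Y))"
    proof (intro sum.cong refl)
      fix Y assume "Y \<in> Pow Z"
      then have Y: "Y \<subseteq> Z" "finite Y" using fZ finite_subset by auto
      show "(\<Sum>R\<in>{R\<in>D. set R = Y}. ?s R * word_sum y \<phi> (Z - set R)) =
        word_sum y (\<lambda>Y. if Y = {} then 1 else 0) Y * word_sum y \<phi> (Z - Y)"
      proof (cases "Y = {}")
        case False
        then have "{R\<in>D. set R = Y} = permutations_of_set Y"
          using Y by (auto simp: D_def permutations_of_set_def)
        then show ?thesis unfolding word_sum_delta[OF Y(2)] using False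
          by (auto simp: sum_distrib_right permutations_of_set_def intro!: sum.cong)
      qed (auto simp: D_def)
    qed
    finally show ?thesis .
  qed
  ultimately show ?thesis by (simp add: algebra_simps)
qed

subsection \<open>Exponential generating functions\<close>

lemma sum_Pow_card:
  fixes F :: "nat \<Rightarrow> 'b::comm_semiring_1"
  assumes "finite Z"
  shows "(\<Sum>Y\<in>Pow Z. F (card Y)) = (\<Sum>k\<le>card Z. of_nat (card Z choose k) * F k)"
proof -
  have "(\<Sum>Y\<in>Pow Z. F (card Y)) = (\<Sum>k\<le>card Z. \<Sum>Y\<in>{Y\<in>Pow Z. card Y = k}. F (card Y))"
    by (rule sum.group[symmetric]) (use assms in \<open>auto intro: card_mono\<close>)
  also have "\<dots> = (\<Sum>k\<le>card Z. of_nat (card {Y\<in>Pow Z. card Y = k}) * F k)"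
    by (intro sum.cong refl) simp
  also have "\<dots> = (\<Sum>k\<le>card Z. of_nat (card Z choose k) * F k)"
    using n_subsets[OF assms] by (intro sum.cong refl) (simp add: Pow_def)
  finally show ?thesis .
qed

text \<open>The set \<open>{..<n}\<close> is a representative: by \<open>word_sum_card_aux\<close>
  every set of \<open>n\<close> naturals gives the same value.\<close>

definition word_num :: "'b::comm_ring_1 \<Rightarrow> (nat \<Rightarrow> 'b) \<Rightarrow> nat \<Rightarrow> 'b" where
  "word_num y f n = word_sum y (\<lambda>Y. f (card Y)) {..<n}"

lemma word_num_0 [simp]: "word_num y f 0 = 0"
  by (simp add: word_num_def)

text \<open>Independence of the set and the recursion are proved together. Removing the largest
  letter leaves only smaller sets, where the values depend on cardinality alone by induction, so the
  right-hand side of \<open>word_sum_rec\<close> depends only on \<open>n\<close>.\<close>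

lemma word_sum_card_aux:
  fixes y :: "'b::comm_ring_1"
  shows "(\<forall>X::nat set. \<forall>f. finite X \<longrightarrow> card X = n \<longrightarrow>
      word_sum y (\<lambda>Y. f (card Y)) X = word_num y f n) \<and>
    (\<forall>f m. n = Suc m \<longrightarrow> word_num y f n = f m + 2 * word_num y f m
    + y * (\<Sum>k\<le>m. of_nat (m choose k) * (word_num y (\<lambda>i. if i = 0 then 1 else 0) k * word_num y f (m - k)))
    + (1 - y) * word_num y (word_num y f) m)"
proof (induction n rule: less_induct)
  case (less n)
  have IH: "word_sum y (\<lambda>Y. f (card Y)) X = word_num y f (card X)"
    if "finite X" "card X < n" for X :: "nat set" and f
    using less that by blast
  show ?case
  proof (cases n)
    case (Suc m)
    let ?\<delta> = "\<lambda>i::nat. if i = 0 then 1 else 0 :: 'b"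
    let ?r = "\<lambda>f. f m + 2 * word_num y f m
      + y * (\<Sum>k\<le>m. of_nat (m choose k) * (word_num y ?\<delta> k * word_num y f (m - k)))
      + (1 - y) * word_num y (word_num y f) m"
    have *: "word_sum y (\<lambda>Y. f (card Y)) X = ?r f" if X: "finite X" "card X = n" for X :: "nat set" and f
    proof -
      define Z where "Z = X - {Max X}"
      have ne: "X \<noteq> {}" using X Suc by auto
      then have Z: "finite Z" "card Z = m" using X Suc Max_in[of X] by (auto simp: Z_def)
      have sub: "finite Y \<and> card Y < n" if "Y \<subseteq> Z" for Y
        using that Z Suc finite_subset[of Y Z] card_mono[of Z Y] by auto
      have eq: "word_sum y (\<lambda>Y. f (card Y)) Y = word_num y f (card Y)" if "Y \<subseteq> Z" for Y f
        using sub[OF that] by (intro IH) auto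
      have "(\<Sum>Y\<in>Pow Z. word_sum y (\<lambda>Y. if Y = {} then 1 else 0) Y *
          word_sum y (\<lambda>Y. f (card Y)) (Z - Y))
        = (\<Sum>Y\<in>Pow Z. (\<lambda>k. word_num y ?\<delta> k * word_num y f (m - k)) (card Y))"
      proof (intro sum.cong refl)
        fix Y assume "Y \<in> Pow Z"
        then have Y: "Y \<subseteq> Z" by simp
        then have fin: "finite Y" using sub by blast
        have "word_sum y (\<lambda>Y. if Y = {} then 1 else 0) Y = word_sum y (\<lambda>Y. ?\<delta> (card Y)) Y"
          using finite_subset[OF _ fin] by (intro word_sum_cong) auto
        moreover have "card (Z - Y) = m - card Y" using Y Z fin by (simp add: card_Diff_subset)
        ultimately show "word_sum y (\<lambda>Y. if Y = {} then 1 else 0) Y *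
          word_sum y (\<lambda>Y. f (card Y)) (Z - Y) = word_num y ?\<delta> (card Y) * word_num y f (m - card Y)"
          using eq[of Y ?\<delta>] eq[of "Z - Y" f] Y by simp
      qed
      moreover have "word_sum y (word_sum y (\<lambda>Y. f (card Y))) Z = word_num y (word_num y f) m"
      proof -
        have "word_sum y (word_sum y (\<lambda>Y. f (card Y))) Z = word_sum y (\<lambda>Y. word_num y f (card Y)) Z"
          by (intro word_sum_cong eq)
        then show ?thesis using eq[of Z "word_num y f"] Z by simp
      qed
      moreover have "word_sum y (\<lambda>Y. f (card Y)) Z = word_num y f m" using eq[of Z f] Z by simp
      ultimately show ?thesis
        unfolding word_sum_rec[OF X(1) ne, of y "\<lambda>Y. f (card Y)", folded Z_def]
        using sum_Pow_card[OF Z(1), of "\<lambda>k. word_num y ?\<delta> k * word_num y f (m - k)"] Z(2)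
        by simp
    qed
    have "word_num y f n = ?r f" for f
      unfolding word_num_def[of y f n] by (rule *) auto
    then show ?thesis using * Suc by simp
  qed simp
qed

lemma word_num_Suc:
  "word_num y f (Suc m) = f m + 2 * word_num y f m
    + y * (\<Sum>k\<le>m. of_nat (m choose k) * (word_num y (\<lambda>i. if i = 0 then 1 else 0) k * word_num y f (m - k)))
    + (1 - y) * word_num y (word_num y f) m"
  using word_sum_card_aux[of "Suc m" y] by blast

lemma word_num_delta:
  "word_num y (\<lambda>i. if i = 0 then 1 else 0) n =
    (if n = 0 then 0 else \<Sum>w\<in>permutations_of_set {1..n}. y ^ des (stack_sort w))"
proof -
  have "word_num y (\<lambda>i. if i = 0 then 1 else 0) n = word_sum y (\<lambda>Y. if card Y = 0 then 1 else 0) {1..n}"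
    using conjunct1[OF word_sum_card_aux[of n y], rule_format, of "{1..n}" "\<lambda>i. if i = 0 then 1 else 0"]
    by simp
  also have "\<dots> = word_sum y (\<lambda>Y. if Y = {} then 1 else 0) {1..n}"
    by (intro word_sum_cong) (auto dest: finite_subset)
  finally show ?thesis by (simp add: word_sum_delta)
qed

text \<open>The operator \<open>word_sum y\<close> read on exponential generating functions:
  \<open>fact k * F $ k\<close> is the value of the set function at sets of \<open>k\<close>
  elements.\<close>

definition word_op :: "'b::field_char_0 \<Rightarrow> 'b fps \<Rightarrow> 'b fps" where
  "word_op y F = Abs_fps (\<lambda>n. word_num y (\<lambda>k. fact k * F $ k) n / fact n)"

lemma word_op_nth_0 [simp]: "word_op y F $ 0 = 0"
  by (simp add: word_op_def)

lemma word_op_1_nth: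
  "n > 0 \<Longrightarrow> word_op y 1 $ n = (\<Sum>w\<in>permutations_of_set {1..n}. y ^ des (stack_sort w)) / fact n"
proof -
  assume n: "n > 0"
  have "(\<lambda>k. fact k * (1 :: 'a fps) $ k) = (\<lambda>i. if i = 0 then 1 else 0)"
    by (auto simp: fun_eq_iff)
  then show ?thesis using n word_num_delta[of y n] by (simp add: word_op_def)
qed

text \<open>The index shift in \<open>word_num_Suc\<close> becomes a derivative and the binomial
  convolution a product. This is the differential equation for the kernel, integrated against
  \<open>F\<close>; the summand \<open>F\<close> is the boundary term.\<close>

lemma fps_deriv_word_op:
  fixes y :: "'b::field_char_0"
  shows "fps_deriv (word_op y F) = F + 2 * word_op y F
    + fps_const y * (word_op y 1 * word_op y F) + fps_const (1 - y) * word_op y (word_op y F)"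
proof (rule fps_ext)
  fix n
  define f where "f = (\<lambda>k. fact k * F $ k)"
  have one: "(\<lambda>k. fact k * (1 :: 'b fps) $ k) = (\<lambda>i. if i = 0 then 1 else 0)"
    by (auto simp: fun_eq_iff)
  let ?d = "word_num y (\<lambda>i. if i = 0 then 1 else 0)"
  have nth: "word_op y F $ k = word_num y f k / fact k" for k
    by (simp add: word_op_def f_def)
  have nth1: "word_op y 1 $ k = ?d k / fact k" for k
    unfolding word_op_def one by simp
  have nth2: "word_op y (word_op y F) $ k = word_num y (word_num y f) k / fact k" for k
    unfolding word_op_def[of y "word_op y F"] nth by simp
  have "(word_op y 1 * word_op y F) $ n
      = (\<Sum>k\<le>n. of_nat (n choose k) * (?d k * word_num y f (n - k))) / fact n"
    unfolding fps_mult_nth nth nth1 sum_divide_distrib atLeast0AtMost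
    by (intro sum.cong refl) (simp add: binomial_fact field_simps)
  moreover have "of_nat (Suc n) * (word_num y f (Suc n) / fact (Suc n)) = word_num y f (Suc n) / fact n"
    by (simp add: field_simps del: of_nat_Suc)
  moreover have "(2 * word_op y F) $ n = 2 * (word_num y f n / fact n)"
    by (simp add: nth fps_numeral_fps_const)
  moreover have "F $ n = f n / fact n" by (simp add: f_def)
  ultimately show "fps_deriv (word_op y F) $ n = (F + 2 * word_op y F
    + fps_const y * (word_op y 1 * word_op y F) + fps_const (1 - y) * word_op y (word_op y F)) $ n"
    unfolding fps_deriv_nth
    by (simp add: nth nth2 word_num_Suc add_divide_distrib mult.assoc del: of_nat_Suc fact_Suc)
qed

section \<open>Formal Borel and Laplace transforms\<close>

definition borel_fps :: "'b::field_char_0 fps \<Rightarrow> 'b fps" where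
  "borel_fps F = Abs_fps (\<lambda>n. F $ n / fact n)"

definition laplace_fps :: "'b::field_char_0 fps \<Rightarrow> 'b fps" where
  "laplace_fps F = Abs_fps (\<lambda>n. fact n * F $ n)"

lemma borel_fps_nth [simp]: "borel_fps F $ n = F $ n / fact n"
  and laplace_fps_nth [simp]: "laplace_fps F $ n = fact n * F $ n"
  by (simp_all add: borel_fps_def laplace_fps_def)

lemma borel_laplace_fps [simp]: "borel_fps (laplace_fps F) = F"
  and laplace_borel_fps [simp]: "laplace_fps (borel_fps F) = F"
  by (simp_all add: fps_eq_iff)

text \<open>Under the Laplace transform, integration from 0 becomes multiplication by
  \<open>fps_X\<close>; this makes the differential equations algebraic.\<close>

lemma laplace_fps_deriv:
  "laplace_fps F = fps_const (F $ 0) + fps_X * laplace_fps (fps_deriv F)"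
proof (rule fps_ext)
  fix n show "laplace_fps F $ n = (fps_const (F $ 0) + fps_X * laplace_fps (fps_deriv F)) $ n"
    by (cases n) (auto simp: algebra_simps)
qed

lemma laplace_fps_add: "laplace_fps (F + G) = laplace_fps F + laplace_fps G"
  and laplace_fps_const_mult: "laplace_fps (fps_const a * F) = fps_const a * laplace_fps F"
  and laplace_fps_uminus: "laplace_fps (- F) = - laplace_fps F"
  by (simp_all add: fps_eq_iff algebra_simps)

text \<open>An operator with \<open>V F = X (F + b V F + c V (V F))\<close> commutes with multiplication by power
  series, since its coefficients are determined recursively.\<close>

lemma fps_quadratic_operator:
  fixes V :: "'b::comm_ring_1 fps \<Rightarrow> 'b fps"
  assumes V: "\<And>F. V F = fps_X * (F + fps_const b * V F + fps_const c * V (V F))"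
  defines "\<omega> \<equiv> V 1"
  shows "V F = \<omega> * F"
    and "\<omega> = fps_X * (1 + fps_const b * \<omega> + fps_const c * (\<omega> * \<omega>))"
proof -
  have V0: "V F $ 0 = 0" for F by (subst V) simp
  have VS: "V F $ Suc n = F $ n + b * V F $ n + c * V (V F) $ n" for F n
    by (subst V) simp
  \<comment> \<open>The induction is over all \<open>F\<close> at once, because the recursion
    \<open>VS\<close> applies \<open>V\<close> to the series \<open>V F\<close>.\<close>
  have main: "\<forall>F. \<forall>k\<le>n. V F $ k = (\<omega> * F) $ k" for n
  proof (induction n)
    case 0
    show ?case using V0 by (simp add: \<omega>_def fps_mult_nth)
  next
    case (Suc n)
    have w0: "\<omega> $ 0 = 0" unfolding \<omega>_def by (rule V0)
    have S: "V F $ Suc k = ((1 + fps_const b * \<omega> + fps_const c * (\<omega> * \<omega>)) * F) $ k" if "k \<le> n" for F k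
    proof -
      have "V (V F) $ k = (\<omega> * V F) $ k" using Suc that by blast
      also have "\<dots> = (\<omega> * (\<omega> * F)) $ k"
        unfolding fps_mult_nth[of \<omega> "V F"] fps_mult_nth[of \<omega> "\<omega> * F"] using Suc that
        by (intro sum.cong refl arg_cong2[where f = "(*)"]) auto
      finally have "V F $ Suc k = F $ k + b * (\<omega> * F) $ k + c * (\<omega> * (\<omega> * F)) $ k"
        using Suc that by (simp add: VS)
      also have "\<dots> = (F + fps_const b * (\<omega> * F) + fps_const c * (\<omega> * (\<omega> * F))) $ k"
        by simp
      finally show ?thesis by (simp only: distrib_right mult_1 mult.assoc)
    qed
    have w: "\<omega> $ Suc k = (1 + fps_const b * \<omega> + fps_const c * (\<omega> * \<omega>)) $ k" if "k \<le> n" for k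
      using S[OF that, of 1] by (simp add: \<omega>_def)
    have "V F $ Suc n = (\<omega> * F) $ Suc n" for F
    proof -
      have "(\<omega> * F) $ Suc n = (\<Sum>i\<le>n. \<omega> $ Suc i * F $ (n - i))"
        unfolding fps_mult_nth atLeast0AtMost sum.atMost_Suc_shift by (simp add: w0)
      also have "\<dots> = (\<Sum>i\<le>n. (1 + fps_const b * \<omega> + fps_const c * (\<omega> * \<omega>)) $ i * F $ (n - i))"
        by (intro sum.cong refl) (simp add: w)
      also have "\<dots> = V F $ Suc n" by (simp only: S[OF order_refl] fps_mult_nth[of _ F] atLeast0AtMost)
      finally show ?thesis by simp
    qed
    then show ?case using Suc le_Suc_eq by metis
  qed
  then show *: "V F = \<omega> * F" for F by (auto simp: fps_eq_iff)
  show "\<omega> = fps_X * (1 + fps_const b * \<omega> + fps_const c * (\<omega> * \<omega>))"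
    using V[of 1] *[of \<omega>] by (simp add: \<omega>_def)
qed

text \<open>This is the series \<open>y (1 + A)\<close>. The factor \<open>y\<close> provides the
  \<open>+ 1\<close> added to the number of descents, and the constant coefficient is
  \<open>y\<close>.\<close>

definition descent_egf :: "'b::field_char_0 \<Rightarrow> 'b fps" where
  "descent_egf y = fps_const y * (1 + word_op y 1)"

lemma descent_egf_nth:
  "descent_egf y $ n = y * (\<Sum>w\<in>permutations_of_set {1..n}. y ^ des (stack_sort w)) / fact n"
  by (cases "n = 0") (simp_all add: descent_egf_def word_op_1_nth)

text \<open>Conjugating \<open>word_op y\<close> by \<open>E\<close> and by the Laplace transform
  gives an operator \<open>V\<close> as in \<open>fps_quadratic_operator\<close>, hence
  multiplication by a series \<open>\<omega>\<close>. In these terms the equation for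
  \<open>E\<close> reads \<open>M = 1 - y X (1 + \<omega>) M\<close> for its Laplace transform
  \<open>M\<close>, and the quadratic equation for \<open>\<omega>\<close> makes the solution
  polynomial in \<open>\<omega>\<close>.\<close>

lemma descent_egf_log_deriv:
  fixes y :: "'b::field_char_0"
  obtains \<omega> E where
    "\<omega> = fps_X * (1 + fps_const (2 - y) * \<omega> + fps_const (1 - y) * (\<omega> * \<omega>))"
    "fps_deriv E = - (descent_egf y * E)"
    "E = borel_fps (1 - fps_const y * fps_X - fps_const (y * (1 - y)) * fps_X * \<omega>)"
proof -
  define T where "T = descent_egf y"
  \<comment> \<open>This is the exponential of minus the antiderivative of \<open>T\<close>, the
    solution of \<open>E' = - T E\<close> with constant coefficient 1.\<close>
  define E where "E = fps_compose (fps_exp 1) (- fps_integral0 T)"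
  have E0: "E $ 0 = 1" by (simp add: E_def)
  have dE: "fps_deriv E = - (T * E)"
    by (simp add: E_def fps_compose_deriv fps_deriv_fps_integral mult.commute)
  have inv: "E * inverse E = 1" "inverse E * E = 1"
    using E0 by (simp_all add: inverse_mult_eq_1 inverse_mult_eq_1')
  define V where "V = (\<lambda>F. laplace_fps (E * word_op y (inverse E * borel_fps F)))"
  have V_eq: "V F = laplace_fps (E * word_op y (inverse E * borel_fps F))" for F
    by (simp add: V_def)
  have const_eqs: "fps_const (2 - y) = 2 - fps_const y" "fps_const (1 - y) = 1 - fps_const y"
    "fps_const (y * (1 - y)) = fps_const y * (1 - fps_const y)"
    by (simp_all add: fps_eq_iff fps_numeral_nth)
  have VV: "V F = fps_X * (F + fps_const (2 - y) * V F + fps_const (1 - y) * V (V F))" for F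
  proof -
    define H where "H = word_op y (inverse E * borel_fps F)"
    have "fps_deriv (E * H) = - (T * E) * H + E * (inverse E * borel_fps F + 2 * H
        + fps_const y * (word_op y 1 * H) + fps_const (1 - y) * word_op y H)"
      unfolding fps_deriv_mult dE H_def fps_deriv_word_op by (simp add: algebra_simps)
    \<comment> \<open>The part \<open>- y A E H\<close> of \<open>- T E H\<close> cancels the
      product term of \<open>fps_deriv_word_op\<close>; the part \<open>- y E H\<close> lowers the
      coefficient 2 to \<open>2 - y\<close>.\<close>
    also have "\<dots> = (E * inverse E) * borel_fps F + fps_const (2 - y) * (E * H) + fps_const (1 - y) * (E * word_op y H)"
      unfolding T_def descent_egf_def const_eqs by (simp add: algebra_simps)
    also have "E * word_op y H = borel_fps (V (V F))"
    proof -
      have "inverse E * borel_fps (V F) = H"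
        unfolding V_eq H_def[symmetric] by (simp add: mult.assoc[symmetric] inv)
      then show ?thesis by (subst V_eq) simp
    qed
    finally have "laplace_fps (fps_deriv (E * H)) = F + fps_const (2 - y) * V F + fps_const (1 - y) * V (V F)"
      unfolding inv V_eq[of F] H_def[symmetric]
      by (simp add: laplace_fps_add laplace_fps_const_mult)
    moreover have "V F = fps_X * laplace_fps (fps_deriv (E * H))"
      unfolding V_eq[of F] H_def[symmetric] by (subst laplace_fps_deriv) (simp add: H_def)
    ultimately show ?thesis by simp
  qed
  define \<omega> where "\<omega> = V 1"
  note q = fps_quadratic_operator[of V, OF VV, folded \<omega>_def]
  define M where "M = laplace_fps E"
  \<comment> \<open>For the argument \<open>M\<close> the series
    \<open>inverse E * borel_fps M\<close> is 1, so \<open>V M\<close> is the transform of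
    \<open>E * word_op y 1\<close>.\<close>
  have wM: "\<omega> * M = laplace_fps (E * word_op y 1)"
    unfolding q(1)[symmetric] by (simp add: V_def M_def inv)
  have "laplace_fps (fps_deriv E) = - fps_const y * (M + \<omega> * M)"
  proof -
    have "fps_deriv E = - (fps_const y * (E + E * word_op y 1))"
      unfolding dE T_def descent_egf_def by (simp add: algebra_simps)
    then show ?thesis using wM
      by (simp only: M_def laplace_fps_uminus laplace_fps_add laplace_fps_const_mult mult_minus_left)
  qed
  moreover have "M = 1 + fps_X * laplace_fps (fps_deriv E)"
    using laplace_fps_deriv[of E] by (simp add: M_def E0)
  ultimately have M: "M = 1 + fps_X * (- fps_const y * (M + \<omega> * M))" by argo
  have "M * (1 + Y * fps_X * (1 + \<omega>)) = M - fps_X * (- Y * (M + \<omega> * M))" for Y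
    by (simp add: algebra_simps)
  also have "M - fps_X * (- fps_const y * (M + \<omega> * M)) = 1"
    by (subst (1) M) (rule add_diff_cancel_right')
  finally have inv1: "M * (1 + fps_const y * fps_X * (1 + \<omega>)) = 1" .
  \<comment> \<open>The product differs from 1 by a multiple of the quadratic equation for
    \<open>\<omega>\<close>, so the reciprocal is found without division.\<close>
  have inv2: "(1 + fps_const y * fps_X * (1 + \<omega>)) *
      (1 - fps_const y * fps_X - fps_const (y * (1 - y)) * fps_X * \<omega>) = 1"
  proof -
    define Y where "Y = fps_const y"
    have eq: "\<omega> = fps_X * (1 + (2 - Y) * \<omega> + (1 - Y) * (\<omega> * \<omega>))"
      using q(2) unfolding const_eqs Y_def .
    have "(1 + Y * fps_X * (1 + \<omega>)) * (1 - Y * fps_X - Y * (1 - Y) * fps_X * \<omega>)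
      = 1 + Y * Y * fps_X * (\<omega> - fps_X * (1 + (2 - Y) * \<omega> + (1 - Y) * (\<omega> * \<omega>)))"
      by (simp add: algebra_simps)
    also have "\<omega> - fps_X * (1 + (2 - Y) * \<omega> + (1 - Y) * (\<omega> * \<omega>)) = 0"
      by (subst right_minus_eq) (rule eq)
    finally show ?thesis unfolding const_eqs Y_def by (simp only: mult_zero_right add_0_right)
  qed
  have "M = 1 - fps_const y * fps_X - fps_const (y * (1 - y)) * fps_X * \<omega>"
    using arg_cong[OF inv2, of "(*) M"] unfolding mult.assoc[symmetric] inv1 by simp
  then have "E = borel_fps (1 - fps_const y * fps_X - fps_const (y * (1 - y)) * fps_X * \<omega>)"
    by (metis M_def borel_laplace_fps)
  then show thesis using that q(2) dE unfolding T_def by blast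
qed

subsection \<open>Coefficient bounds\<close>

text \<open>A truncated weighted l1 norm, submultiplicative by \<open>wnorm_mult\<close>. Truncation
  allows bounds by induction on \<open>N\<close>. The radius 1/4 is that of the extreme case
  \<open>c = 1\<close>, where \<open>\<omega> = X (1 + \<omega>)^2\<close> is a Catalan
  series.\<close>

definition wnorm :: "nat \<Rightarrow> complex fps \<Rightarrow> real" where
  "wnorm N F = (\<Sum>k\<le>N. norm (fps_nth F k) * (1/4) ^ k)"

lemma wnorm_nonneg [simp]: "0 \<le> wnorm N F"
  by (simp add: wnorm_def sum_nonneg)

lemma wnorm_mono: "M \<le> N \<Longrightarrow> wnorm M F \<le> wnorm N F"
  unfolding wnorm_def by (intro sum_mono2) auto

lemma wnorm_add: "wnorm N (F + G) \<le> wnorm N F + wnorm N G"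
  unfolding wnorm_def sum.distrib[symmetric] distrib_right[symmetric]
  by (intro sum_mono mult_right_mono) (auto intro: norm_triangle_ineq)

lemma wnorm_const_mult: "wnorm N (fps_const a * F) = norm a * wnorm N F"
  by (simp add: wnorm_def norm_mult sum_distrib_left mult.assoc)

lemma wnorm_1 [simp]: "wnorm N 1 = 1"
proof -
  have "wnorm N 1 = (\<Sum>k\<in>{0}. norm (fps_nth (1 :: complex fps) k) * (1/4) ^ k)"
    unfolding wnorm_def by (intro sum.mono_neutral_right) auto
  then show ?thesis by simp
qed

lemma wnorm_uminus [simp]: "wnorm N (- F) = wnorm N F"
  by (simp add: wnorm_def)

lemma wnorm_mult: "wnorm N (F * G) \<le> wnorm N F * wnorm N G"
proof -
  let ?a = "\<lambda>k. norm (fps_nth F k) * (1/4) ^ k" and ?b = "\<lambda>k. norm (fps_nth G k) * (1/4) ^ k"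
  have "wnorm N (F * G) \<le> (\<Sum>k\<le>N. \<Sum>i\<le>k. ?a i * ?b (k - i))"
    unfolding wnorm_def
  proof (rule sum_mono)
    fix k
    have "norm (fps_nth (F * G) k) * (1/4) ^ k \<le> (\<Sum>i\<le>k. norm (fps_nth F i * fps_nth G (k - i))) * (1/4) ^ k"
      unfolding fps_mult_nth atLeast0AtMost by (intro mult_right_mono norm_sum) auto
    also have "\<dots> = (\<Sum>i\<le>k. ?a i * ?b (k - i))"
      unfolding sum_distrib_right
      by (intro sum.cong refl) (simp add: norm_mult power_add[symmetric] mult_ac del: power_divide power_one_over)
    finally show "norm (fps_nth (F * G) k) * (1/4) ^ k \<le> (\<Sum>i\<le>k. ?a i * ?b (k - i))" .
  qed
  also have "\<dots> = (\<Sum>(i, j)\<in>{(i, j). i + j \<le> N}. ?a i * ?b j)"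
    by (rule sum.triangle_reindex_eq[symmetric])
  \<comment> \<open>The truncated Cauchy product runs over a triangle of index pairs; enlarging it
    to a square gives the product of the norms.\<close>
  also have "\<dots> \<le> (\<Sum>(i, j)\<in>{..N} \<times> {..N}. ?a i * ?b j)"
    by (intro sum_mono2) auto
  also have "\<dots> = wnorm N F * wnorm N G"
    unfolding wnorm_def sum_product sum.cartesian_product ..
  finally show ?thesis .
qed

lemma wnorm_X_Suc: "wnorm (Suc N) (fps_X * F) = wnorm N F / 4"
  unfolding wnorm_def sum.atMost_Suc_shift by (simp add: sum_divide_distrib)

lemma wnorm_X: "wnorm N (fps_X * F) \<le> wnorm N F / 4"
proof (cases N)
  case 0
  then show ?thesis by (simp add: wnorm_def)
next
  case (Suc M)
  then show ?thesis using wnorm_mono[of M N F] by (simp add: wnorm_X_Suc)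
qed

section \<open>The Motzkin series and its expansion at \<open>c = 0\<close>\<close>

definition geo_fps :: "complex fps" where
  "geo_fps = Abs_fps (\<lambda>_. 1)"

lemma geo_fps_mult: "geo_fps * (1 - fps_X) = 1"
proof -
  have "(geo_fps - fps_X * geo_fps) = 1"
  proof (rule fps_ext)
    fix n show "fps_nth (geo_fps - fps_X * geo_fps) n = fps_nth 1 n"
      by (cases n) (auto simp: geo_fps_def)
  qed
  then show ?thesis by (simp add: algebra_simps)
qed

lemma wnorm_geo_fps: "wnorm N geo_fps \<le> 2"
proof -
  have "wnorm N geo_fps = (\<Sum>k\<le>N. (1/4) ^ k)"
    by (simp add: wnorm_def geo_fps_def)
  also have "\<dots> = (1 - (1/4) ^ Suc N) / (1 - 1/4)"
    by (subst sum_gp0) simp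
  also have "\<dots> \<le> 2"
    using zero_le_power[of "1/4 :: real" "Suc N"] by (simp add: field_simps)
  finally show ?thesis .
qed

text \<open>The series \<open>\<omega>\<close> counts plane trees with at most two children per
  vertex, with weight \<open>1 + c\<close> for each unary and \<open>c\<close> for each binary
  vertex. In the application \<open>c = 1 - y\<close>.\<close>

locale motzkin_fps =
  fixes c :: complex and \<omega> :: "complex fps"
  assumes c: "norm c \<le> 1"
    and omega: "\<omega> = fps_X * (1 + fps_const (1 + c) * \<omega> + fps_const c * (\<omega> * \<omega>))"
begin

text \<open>The value 1 is the double root of \<open>S = (1 + 2 S + S\<^sup>2) / 4\<close>.\<close>

lemma wnorm_omega: "wnorm N \<omega> \<le> 1"
proof (induction N)
  case 0
  have "fps_nth \<omega> 0 = 0" by (subst omega) simp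
  then show ?case by (simp add: wnorm_def)
next
  case (Suc N)
  let ?S = "wnorm N \<omega>"
  have "wnorm (Suc N) \<omega> = wnorm N (1 + fps_const (1 + c) * \<omega> + fps_const c * (\<omega> * \<omega>)) / 4"
    by (subst omega) (rule wnorm_X_Suc)
  also have "wnorm N (1 + fps_const (1 + c) * \<omega> + fps_const c * (\<omega> * \<omega>)) \<le>
     wnorm N 1 + wnorm N (fps_const (1 + c) * \<omega>) + wnorm N (fps_const c * (\<omega> * \<omega>))"
    by (rule order_trans[OF wnorm_add add_right_mono[OF wnorm_add]])
  also have "\<dots> = 1 + norm (1 + c) * ?S + norm c * wnorm N (\<omega> * \<omega>)"
    by (simp add: wnorm_const_mult)
  also have "\<dots> \<le> 1 + 2 * 1 + 1 * (1 * 1)"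
  proof -
    have "norm (1 + c) \<le> 2" using c norm_triangle_ineq[of 1 c] by simp
    moreover have "wnorm N (\<omega> * \<omega>) \<le> 1 * 1"
      by (rule order_trans[OF wnorm_mult]) (intro mult_mono Suc; simp)
    ultimately show ?thesis using c Suc by (intro add_mono mult_mono) auto
  qed
  finally show ?case by simp
qed

lemma wnorm_1_add_omega: "wnorm N (1 + \<omega>) \<le> 2"
  using wnorm_add[of N 1 \<omega>] wnorm_omega[of N] by simp

text \<open>The series \<open>\<omega>0 = X / (1 - X)\<close> is the solution at
  \<open>c = 0\<close>. By \<open>omega_eq\<close>, \<open>\<delta>\<close> serves as the difference
  quotient of \<open>\<omega>\<close> in \<open>c\<close>, and \<open>\<delta>0\<close> is the
  derivative at \<open>c = 0\<close>.\<close>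

definition \<omega>0 :: "complex fps" where "\<omega>0 = fps_X * geo_fps"
definition \<delta> :: "complex fps" where "\<delta> = fps_X * geo_fps * (\<omega> * (1 + \<omega>))"
definition \<delta>0 :: "complex fps" where "\<delta>0 = fps_X * geo_fps * (\<omega>0 * (1 + \<omega>0))"

lemma wnorm_omega0: "wnorm N \<omega>0 \<le> 1"
  using wnorm_X[of N geo_fps] wnorm_geo_fps[of N] by (simp add: \<omega>0_def)

text \<open>The quadratic equation rearranges to
  \<open>(1 - X) \<omega> = X + c X \<omega> (1 + \<omega>)\<close>; it remains to multiply by
  \<open>geo_fps\<close>.\<close>

lemma omega_eq: "\<omega> = \<omega>0 + fps_const c * \<delta>"
proof -
  have "\<omega> = (geo_fps * (1 - fps_X)) * \<omega>" by (simp add: geo_fps_mult)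
  also have "\<dots> = geo_fps * (\<omega> - fps_X * \<omega>)" by (simp add: algebra_simps)
  also have "\<omega> - fps_X * \<omega> = fps_X + fps_X * fps_const c * (\<omega> * (1 + \<omega>))"
  proof -
    have "\<omega> = fps_X * (1 + (1 + fps_const c) * \<omega> + fps_const c * (\<omega> * \<omega>))"
      using omega unfolding fps_const_add[symmetric] fps_const_1_eq_1 .
    moreover have "fps_X * (1 + (1 + C) * w + C * (w * w)) - fps_X * w
       = fps_X + fps_X * C * (w * (1 + w))" for w C :: "complex fps"
      by (simp add: algebra_simps)
    ultimately show ?thesis by metis
  qed
  also have "geo_fps * \<dots> = \<omega>0 + fps_const c * \<delta>"
    by (simp add: \<omega>0_def \<delta>_def algebra_simps)
  finally show ?thesis .
qed

lemma wnorm_delta: "wnorm N \<delta> \<le> 1"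
proof -
  have "wnorm N \<delta> \<le> wnorm N (geo_fps * (\<omega> * (1 + \<omega>))) / 4"
    unfolding \<delta>_def mult.assoc by (rule wnorm_X)
  also have "wnorm N (geo_fps * (\<omega> * (1 + \<omega>))) \<le> wnorm N geo_fps * (wnorm N \<omega> * wnorm N (1 + \<omega>))"
    by (meson mult_left_mono order_trans wnorm_mult wnorm_nonneg)
  also have "\<dots> \<le> 2 * (1 * 2)"
    by (intro mult_mono wnorm_geo_fps wnorm_omega wnorm_1_add_omega) auto
  finally show ?thesis by simp
qed

text \<open>The difference factors through \<open>\<omega> - \<omega>0 = c \<delta>\<close>. Hence
  \<open>\<omega>0 + c \<delta>0\<close> approximates \<open>\<omega>\<close> to second order in
  \<open>c\<close>.\<close>

lemma wnorm_delta_diff: "wnorm N (\<delta> - \<delta>0) \<le> 2 * norm c"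
proof -
  have "\<delta> - \<delta>0 = fps_X * (geo_fps * ((\<omega> - \<omega>0) * (1 + \<omega> + \<omega>0)))"
    by (simp add: \<delta>_def \<delta>0_def algebra_simps)
  also have "\<omega> - \<omega>0 = fps_const c * \<delta>" using omega_eq by (metis add_diff_cancel_left')
  also have "fps_X * (geo_fps * (fps_const c * \<delta> * (1 + \<omega> + \<omega>0)))
     = fps_X * (fps_const c * (geo_fps * (\<delta> * (1 + \<omega> + \<omega>0))))" by (simp add: algebra_simps)
  finally have "wnorm N (\<delta> - \<delta>0) \<le> norm c * wnorm N (geo_fps * (\<delta> * (1 + \<omega> + \<omega>0))) / 4"
    using wnorm_X[of N] by (metis wnorm_const_mult)
  also have "wnorm N (geo_fps * (\<delta> * (1 + \<omega> + \<omega>0))) \<le> wnorm N geo_fps * (wnorm N \<delta> * wnorm N (1 + \<omega> + \<omega>0))"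
    by (meson mult_left_mono order_trans wnorm_mult wnorm_nonneg)
  also have "\<dots> \<le> 2 * (1 * 4)"
    using wnorm_add[of N "1 + \<omega>" \<omega>0] wnorm_omega0[of N] wnorm_1_add_omega[of N]
    by (intro mult_mono wnorm_geo_fps wnorm_delta) auto
  finally show ?thesis by (simp add: mult_left_mono)
qed

end

text \<open>The \<open>k\<close>-th coefficient of \<open>F\<close> is at most
  \<open>C * 4 ^ k\<close>, so after division by \<open>fact k\<close> the series is dominated by
  that of \<open>C * exp (4 * norm z)\<close>.\<close>

lemma borel_fps_wnorm_bound:
  assumes "\<And>N. wnorm N F \<le> C"
  shows "fps_conv_radius (borel_fps F) = \<infinity>"
    and "norm (eval_fps (borel_fps F) z) \<le> C * exp (4 * norm z)"
proof -
  have C: "0 \<le> C" using assms[of 0] wnorm_nonneg[of 0 F] by linarith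
  have F: "norm (fps_nth F k) * (1/4) ^ k \<le> C" for k
  proof -
    have "norm (fps_nth F k) * (1/4) ^ k \<le> wnorm k F"
      unfolding wnorm_def by (rule member_le_sum) auto
    then show ?thesis using assms[of k] by linarith
  qed
  have b: "norm (fps_nth (borel_fps F) k * z ^ k) \<le> C * ((4 * norm z) ^ k / fact k)" for z k
  proof -
    have "norm (fps_nth (borel_fps F) k * z ^ k)
        = (norm (fps_nth F k) * (1/4) ^ k) * ((4 * norm z) ^ k / fact k)"
      by (simp add: norm_mult norm_divide norm_power power_mult_distrib power_divide)
    also have "\<dots> \<le> C * ((4 * norm z) ^ k / fact k)"
      by (intro mult_right_mono F) auto
    finally show ?thesis .
  qed
  have s: "(\<lambda>k. C * ((4 * norm z) ^ k / fact k)) sums (C * exp (4 * norm z))" for z :: complex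
    using exp_converges[of "4 * norm z"] by (intro sums_mult) (simp add: divide_inverse mult.commute)
  have sn: "summable (\<lambda>k. norm (fps_nth (borel_fps F) k * z ^ k))" for z
    using s[of z] by (intro summable_comparison_test[OF _ sums_summable[OF s[of z]]])
      (use b in auto)
  show "fps_conv_radius (borel_fps F) = \<infinity>"
    unfolding fps_conv_radius_def by (rule conv_radius_inftyI'') (rule summable_norm_cancel[OF sn])
  have "norm (eval_fps (borel_fps F) z) \<le> (\<Sum>k. norm (fps_nth (borel_fps F) k * z ^ k))"
    unfolding eval_fps_def by (rule summable_norm[OF sn])
  also have "\<dots> \<le> C * exp (4 * norm z)"
    unfolding sums_unique[OF s] by (intro suminf_le b sn sums_summable[OF s])
  finally show "norm (eval_fps (borel_fps F) z) \<le> C * exp (4 * norm z)" .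
qed

lemma borel_fps_add: "borel_fps (F + G) = borel_fps F + borel_fps G"
  and borel_fps_diff: "borel_fps (F - G) = borel_fps F - borel_fps G"
  and borel_fps_const_mult: "borel_fps (fps_const a * F) = fps_const a * borel_fps F"
  by (simp_all add: fps_eq_iff add_divide_distrib diff_divide_distrib)

lemma borel_fps_1 [simp]: "borel_fps 1 = 1"
  and borel_fps_X [simp]: "borel_fps fps_X = fps_X"
  by (auto simp: fps_eq_iff fps_X_def)

lemma fps_deriv_borel_fps: "fps_deriv (borel_fps (fps_X * F)) = borel_fps F"
  by (simp add: fps_eq_iff field_simps del: of_nat_Suc)

subsection \<open>Coefficient asymptotics near a simple zero\<close>

lemma norm_deriv_bound_imp_slope:
  fixes h :: "complex \<Rightarrow> complex"
  assumes hol: "h holomorphic_on S" and S: "open S" "convex S" "a \<in> S" "x \<in> S"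
    and h': "\<And>x. x \<in> S \<Longrightarrow> norm (deriv h x) \<le> B"
  shows "norm (h x - h a) \<le> B * norm (x - a)"
  by (rule field_differentiable_bound[OF S(2) _ h' S(4,3)])
    (use hol S in \<open>auto intro: has_field_derivative_at_within holomorphic_derivI\<close>)

text \<open>If \<open>E = (\<rho> - x) q\<close>, then \<open>- E' / E = 1 / (\<rho> - x) - (Ln q)'\<close>.\<close>

lemma simple_zero_coeff_asymptotics:
  fixes h :: "complex \<Rightarrow> complex"
  assumes hol: "h holomorphic_on ball 0 2"
    and h: "\<And>x. x \<in> ball 0 2 \<Longrightarrow> norm (h x) \<le> B"
    and h': "\<And>x. x \<in> ball 0 2 \<Longrightarrow> norm (deriv h x) \<le> B"
    and \<epsilon>: "norm \<epsilon> * B \<le> 1/8"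
    and E: "(\<lambda>x. 1 - x + \<epsilon> * h x) has_fps_expansion E"
    and T: "fps_deriv E = - (T * E)"
  obtains \<rho> where "\<rho> = 1 + \<epsilon> * h \<rho>" "norm (\<rho> - 1) \<le> 1/8"
    "\<And>n. norm (fps_nth T n - (1 / \<rho>) ^ Suc n) \<le> real (Suc n) * (2/3) ^ Suc n"
proof -
  let ?S = "ball 0 2 :: complex set"
  have slope: "norm (\<epsilon> * (h x - h a)) \<le> 1/8 * norm (x - a)" if "x \<in> ?S" "a \<in> ?S" for x a
  proof -
    have "norm (\<epsilon> * (h x - h a)) \<le> norm \<epsilon> * (B * norm (x - a))"
      unfolding norm_mult by (intro mult_left_mono norm_deriv_bound_imp_slope[OF hol _ _ _ _ h']) (use that in auto)
    also have "\<dots> \<le> 1/8 * norm (x - a)"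
      using mult_right_mono[OF \<epsilon>, of "norm (x - a)"] by simp
    finally show ?thesis .
  qed
  have sub: "cball 1 (1/8) \<subseteq> ?S"
  proof
    fix x :: complex assume "x \<in> cball 1 (1/8)"
    then have "norm (1 - x) \<le> 1/8" by (simp add: dist_norm)
    then have "norm x \<le> 1 + 1/8" using norm_triangle_ineq4[of 1 "1 - x"] by simp
    then show "x \<in> ?S" by simp
  qed
  have small: "norm (\<epsilon> * h x) \<le> 1/8" if "x \<in> ?S" for x
    using mult_left_mono[OF h[OF that], of "norm \<epsilon>"] \<epsilon> by (simp add: norm_mult)
  \<comment> \<open>The zero is a fixed point of \<open>1 + \<epsilon> * h x\<close>, a contraction
    with factor 1/8 by \<open>slope\<close>.\<close>
  have "\<exists>!x. x \<in> cball 1 (1/8) \<and> 1 + \<epsilon> * h x = x"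
  proof (rule Banach_fix[where c = "1/8"])
    show "(\<lambda>x. 1 + \<epsilon> * h x) ` cball 1 (1/8) \<subseteq> cball 1 (1/8)"
      using small sub by (auto simp: dist_norm)
    show "dist (1 + \<epsilon> * h x) (1 + \<epsilon> * h y) \<le> 1/8 * dist x y"
      if "x \<in> cball 1 (1/8)" "y \<in> cball 1 (1/8)" for x y
      using slope[OF subsetD[OF sub that(1)] subsetD[OF sub that(2)]]
      by (simp add: dist_norm right_diff_distrib)
  qed (auto simp: complete_eq_closed)
  then obtain \<rho> where \<rho>: "\<rho> \<in> cball 1 (1/8)" "\<rho> = 1 + \<epsilon> * h \<rho>" by metis
  have \<rho>2: "1 + \<epsilon> * h \<rho> - \<rho> = 0"
    by (subst right_minus_eq) (rule \<rho>(2)[symmetric])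
  have \<rho>S: "\<rho> \<in> ?S" using \<rho> sub by auto
  have \<rho>0: "\<rho> \<noteq> 0" using \<rho>(1) by auto
  \<comment> \<open>The difference quotient of \<open>h\<close> at the zero, with the removable
    singularity filled in; it gives the cofactor \<open>q = 1 - \<epsilon> * k\<close>, which stays
    within 1/8 of 1.\<close>
  define k where "k = (\<lambda>x. if x = \<rho> then deriv h \<rho> else (h x - h \<rho>) / (x - \<rho>))"
  have holk: "k holomorphic_on ?S"
    unfolding k_def by (rule pole_lemma[OF hol]) (use \<rho>S in \<open>simp add: interior_open\<close>)
  define q where "q = (\<lambda>x. 1 - \<epsilon> * k x)"
  have kb: "norm (\<epsilon> * k x) \<le> 1/8" if "x \<in> ?S" for x
  proof (cases "x = \<rho>")
    case True
    then show ?thesis using mult_left_mono[OF h'[OF \<rho>S], of "norm \<epsilon>"] \<epsilon> by (simp add: k_def norm_mult)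
  next
    case False
    then show ?thesis using slope[OF that \<rho>S] by (simp add: k_def norm_divide field_simps norm_mult)
  qed
  have holq: "q holomorphic_on ?S"
    unfolding q_def by (intro holomorphic_intros holk)
  have Eq: "1 - x + \<epsilon> * h x = (\<rho> - x) * q x" for x
  proof (cases "x = \<rho>")
    case True
    then show ?thesis using \<rho>2 by (simp add: algebra_simps)
  next
    case False
    then have "(\<rho> - x) * k x = h \<rho> - h x" by (simp add: k_def field_simps)
    moreover have "(\<rho> - x) * q x = (\<rho> - x) - \<epsilon> * ((\<rho> - x) * k x)"
      by (simp add: q_def algebra_simps)
    ultimately have "(\<rho> - x) * q x = (\<rho> - x) - \<epsilon> * (h \<rho> - h x)" by (simp only:)
    also have "\<dots> = (1 - x + \<epsilon> * h x) - (1 + \<epsilon> * h \<rho> - \<rho>)"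
      by (simp add: algebra_simps)
    finally show ?thesis unfolding \<rho>2 by simp
  qed
  have qpos: "q x \<notin> \<real>\<^sub>\<le>\<^sub>0" "q x \<noteq> 0" if "x \<in> ?S" for x
  proof -
    have "Re (\<epsilon> * k x) \<le> 1/8" using kb[OF that] complex_Re_le_cmod[of "\<epsilon> * k x"] by linarith
    then have "Re (q x) > 0" by (simp add: q_def)
    then show "q x \<notin> \<real>\<^sub>\<le>\<^sub>0" "q x \<noteq> 0" by (auto simp: complex_nonpos_Reals_iff)
  qed
  define g where "g = (\<lambda>x. Ln (q x))"
  have holg: "g holomorphic_on ?S"
    unfolding g_def by (intro holomorphic_intros holq) (use qpos in auto)
  have gb: "norm (g x) \<le> 1" if "x \<in> ?S" for x
    using norm_Ln_le[of "- (\<epsilon> * k x)"] kb[OF that] by (simp add: g_def q_def)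
  define G where "G = fps_expansion g 0"
  have Gexp: "g has_fps_expansion G"
    unfolding G_def by (rule has_fps_expansion_fps_expansion[OF _ _ holg]) auto
  define Q where "Q = fps_expansion q 0"
  have Qexp: "q has_fps_expansion Q"
    unfolding Q_def by (rule has_fps_expansion_fps_expansion[OF _ _ holq]) auto
  have "(\<lambda>x. (\<rho> - x) * q x) has_fps_expansion (fps_const \<rho> - fps_X) * Q"
    by (intro fps_expansion_intros Qexp)
  then have EQ: "E = (fps_const \<rho> - fps_X) * Q"
    using E fps_expansion_unique_complex unfolding Eq by blast
  have "deriv q x = deriv g x * q x" if "x \<in> ?S" for x
  proof -
    have "(q has_field_derivative deriv q x) (at x)"
      using holq that by (intro holomorphic_derivI[of _ ?S]) auto
    then have "(g has_field_derivative inverse (q x) * deriv q x) (at x)"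
      unfolding g_def using qpos[OF that]
      by (auto intro!: derivative_eq_intros simp: field_simps)
    then have "deriv g x = inverse (q x) * deriv q x" by (rule DERIV_imp_deriv)
    then show ?thesis using qpos[OF that] by simp
  qed
  then have "eventually (\<lambda>x. deriv g x * q x = deriv q x) (nhds 0)"
    by (intro eventually_nhds_in_open[of ?S, THEN eventually_mono]) auto
  moreover have "(\<lambda>x. deriv g x * q x) has_fps_expansion fps_deriv G * Q"
    by (intro fps_expansion_intros Qexp Gexp)
  ultimately have "deriv q has_fps_expansion fps_deriv G * Q"
    using has_fps_expansion_cong[OF _ refl, of "\<lambda>x. deriv g x * q x" "deriv q"] by simp
  then have dQ: "fps_deriv Q = fps_deriv G * Q"
    using has_fps_expansion_deriv[OF Qexp] fps_expansion_unique_complex by blast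
  have "Q \<noteq> 0"
  proof
    assume "Q = 0"
    then have "fps_nth Q 0 = 0" by simp
    then show False using fps_nth_fps_expansion[OF Qexp, of 0] qpos(2)[of 0] by simp
  qed
  define P where "P = Abs_fps (\<lambda>n. (1 / \<rho>) ^ Suc n)"
  have P: "P * (fps_const \<rho> - fps_X) = 1"
  proof -
    have "fps_const \<rho> * P - fps_X * P = 1"
    proof (rule fps_ext)
      fix n show "fps_nth (fps_const \<rho> * P - fps_X * P) n = fps_nth 1 n"
        using \<rho>0 by (cases n) (auto simp: P_def)
    qed
    then show ?thesis by (simp add: algebra_simps)
  qed
  have "- (T * E) = - Q + (fps_const \<rho> - fps_X) * (fps_deriv G * Q)"
    unfolding T[symmetric] by (simp add: EQ dQ fps_deriv_mult)
  then have "(T * (fps_const \<rho> - fps_X)) * Q = (1 - (fps_const \<rho> - fps_X) * fps_deriv G) * Q"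
    unfolding EQ by (simp add: algebra_simps)
  then have TG: "T * (fps_const \<rho> - fps_X) = 1 - (fps_const \<rho> - fps_X) * fps_deriv G"
    using \<open>Q \<noteq> 0\<close> mult_right_cancel by blast
  have "T = (T * (fps_const \<rho> - fps_X)) * P" using P by (simp add: mult.assoc mult.commute)
  also have "\<dots> = P - (P * (fps_const \<rho> - fps_X)) * fps_deriv G"
    unfolding TG by (subst left_diff_distrib) (simp only: mult_1 mult_ac)
  finally have TP: "T = P - fps_deriv G" unfolding P by simp
  have "norm (fps_nth T n - (1 / \<rho>) ^ Suc n) \<le> real (Suc n) * (2/3) ^ Suc n" for n
  proof -
    \<comment> \<open>A Cauchy estimate on the circle of radius 3/2, inside the disc of radius 2;
      this is the source of the factor 2/3.\<close>
    have "norm ((deriv ^^ Suc n) g 0) \<le> fact (Suc n) * 1 / (3/2) ^ Suc n"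
    proof (rule Cauchy_inequality)
      have sub: "cball 0 (3/2) \<subseteq> ?S" by auto
      show "continuous_on (cball 0 (3/2)) g"
        using holomorphic_on_imp_continuous_on[OF holg] sub continuous_on_subset by blast
      show "g holomorphic_on ball 0 (3/2)"
        using holg by (rule holomorphic_on_subset) auto
    qed (use gb in auto)
    then have "norm (fps_nth G (Suc n)) \<le> (2/3) ^ Suc n"
      unfolding fps_nth_fps_expansion[OF Gexp]
      by (simp add: norm_divide field_simps power_divide del: fact_Suc power_Suc)
    moreover have "fps_nth T n - (1 / \<rho>) ^ Suc n = - (of_nat (Suc n) * fps_nth G (Suc n))"
      unfolding TP by (simp add: P_def)
    ultimately show ?thesis
      by (simp only: norm_minus_cancel norm_mult norm_of_nat) (intro mult_left_mono; simp)
  qed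
  moreover have "norm (\<rho> - 1) \<le> 1/8"
    using \<rho>(1) by (simp add: dist_norm norm_minus_commute)
  ultimately show thesis using that[OF \<rho>(2)] by blast
qed

subsection \<open>Perturbation of \<open>1 - x\<close>\<close>

lemma entire_fps_closure:
  fixes F G :: "complex fps"
  assumes "fps_conv_radius F = \<infinity>" "fps_conv_radius G = \<infinity>"
  shows "fps_conv_radius (F + G) = \<infinity>" "fps_conv_radius (F - G) = \<infinity>" "fps_conv_radius (F * G) = \<infinity>"
  using fps_conv_radius_add[of F G] fps_conv_radius_diff[of F G] fps_conv_radius_mult[of F G] assms
  by auto

lemma geo_fps_mult_nth: "fps_nth (geo_fps * F) n = (\<Sum>i\<le>n. fps_nth F i)"
proof -
  have "fps_nth (F * geo_fps) n = (\<Sum>i\<le>n. fps_nth F i)"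
    by (simp add: fps_mult_nth geo_fps_def atLeast0AtMost)
  then show ?thesis by (simp add: mult.commute)
qed

lemma geo_fps_square_nth: "fps_nth (geo_fps * geo_fps) n = of_nat (Suc n)"
  unfolding geo_fps_mult_nth by (simp add: geo_fps_def)

lemma geo_fps_cube_nth: "fps_nth (geo_fps * (geo_fps * geo_fps)) n = of_nat (Suc n) * of_nat (Suc (Suc n)) / 2"
  unfolding geo_fps_mult_nth[of "geo_fps * geo_fps"] geo_fps_square_nth
  by (induction n) (simp_all add: field_simps)

context motzkin_fps
begin

lemma borel_fps_omega0: "borel_fps (fps_X * \<omega>0) = fps_exp 1 - 1 - fps_X"
proof (rule fps_ext)
  fix n
  consider "n = 0" | "n = 1" | m where "n = Suc (Suc m)" by (metis One_nat_def not0_implies_Suc)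
  then show "fps_nth (borel_fps (fps_X * \<omega>0)) n = fps_nth (fps_exp 1 - 1 - fps_X) n"
    by cases (auto simp: \<omega>0_def geo_fps_def algebra_simps)
qed

lemma delta0_eq: "\<delta>0 = fps_X * (fps_X * (geo_fps * (geo_fps * geo_fps)))"
proof -
  have "geo_fps = geo_fps * (1 - fps_X) + fps_X * geo_fps" by (simp add: algebra_simps)
  then have "1 + \<omega>0 = geo_fps" by (simp add: geo_fps_mult \<omega>0_def)
  then show ?thesis unfolding \<delta>0_def by (simp add: \<omega>0_def mult_ac)
qed

text \<open>The coefficient of \<open>fps_X * \<delta>0\<close> at \<open>k > 0\<close> is
  \<open>(k - 1) (k - 2) / 2\<close>, and \<open>(k - 1) (k - 2) = k (k - 1) - 2 k + 2\<close>
  yields the quadratic factor of the exponential. At \<open>k = 0\<close> that formula gives 1 in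
  place of 0, hence the final \<open>- 1\<close>.\<close>

lemma borel_fps_delta0:
  "borel_fps (fps_X * \<delta>0) = fps_const (1/2) * ((fps_X * fps_X - 2 * fps_X + 2) * fps_exp 1) - 1"
proof (rule fps_ext)
  fix n
  have R: "(fps_X * fps_X - 2 * fps_X + 2) * fps_exp 1 =
    fps_X * (fps_X * fps_exp 1) - fps_const 2 * (fps_X * fps_exp 1) + fps_const 2 * fps_exp (1::complex)"
    by (simp add: algebra_simps fps_numeral_fps_const)
  consider "n = 0" | "n = 1" | "n = 2" | m where "n = Suc (Suc (Suc m))"
    by (metis One_nat_def Suc_1 not0_implies_Suc)
  then show "fps_nth (borel_fps (fps_X * \<delta>0)) n =
    fps_nth (fps_const (1/2) * ((fps_X * fps_X - 2 * fps_X + 2) * fps_exp 1) - 1) n"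
  proof cases
    case 3
    then show ?thesis unfolding R by (simp add: delta0_eq numeral_2_eq_2)
  next
    case (4 m)
    have f: "(fact m :: complex) \<noteq> 0" "(of_nat m + 1 :: complex) \<noteq> 0" "(of_nat m + 2 :: complex) \<noteq> 0"
       "(of_nat m + 3 :: complex) \<noteq> 0"
      using of_nat_neq_0[of m, where 'a = complex] of_nat_neq_0[of "Suc m", where 'a = complex]
        of_nat_neq_0[of "Suc (Suc m)", where 'a = complex]
      by (simp_all add: add_ac)
    have e: "fact (Suc m) = (of_nat m + 1 :: complex) * fact m"
      "fact (Suc (Suc m)) = (of_nat m + 2) * ((of_nat m + 1 :: complex) * fact m)"
      "fact (Suc (Suc (Suc m))) = (of_nat m + 3) * ((of_nat m + 2) * ((of_nat m + 1 :: complex) * fact m))"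
      by (simp_all add: algebra_simps)
    have "(of_nat m + 1) * (of_nat m + 2) / 2 / fact (Suc (Suc (Suc m))) =
      (1/2) * (1 / fact (Suc m) - 2 * (1 / fact (Suc (Suc m))) + 2 * (1 / fact (Suc (Suc (Suc m))))) - (0::complex)"
      unfolding e using f by (simp add: divide_simps) (simp add: algebra_simps)?
    then show ?thesis using 4 unfolding R by (simp add: delta0_eq geo_fps_cube_nth add_ac del: fact_Suc)
  qed (auto simp: delta0_eq fps_numeral_nth)
qed

end

text \<open>In terms of \<open>\<epsilon>\<close>, \<open>E\<close> is \<open>1 - x\<close> plus
  \<open>\<epsilon>\<close> times the Borel transform of \<open>X (y \<omega> - 1)\<close>. The
  bounds follow from the norm estimates, with \<open>exp 8 = exp (4 * 2)\<close> on the disc of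
  radius 2. The last claim replaces \<open>\<omega>\<close> by
  \<open>\<omega>0 + c \<delta>0\<close>, whose transform is elementary.\<close>

lemma descent_egf_perturbation:
  fixes y :: complex
  defines "\<epsilon> \<equiv> y - 1"
  assumes "norm \<epsilon> \<le> 1"
  obtains h E where
    "h holomorphic_on ball 0 2"
    "\<And>x. x \<in> ball 0 2 \<Longrightarrow> norm (h x) \<le> 3 * exp 8"
    "\<And>x. x \<in> ball 0 2 \<Longrightarrow> norm (deriv h x) \<le> 3 * exp 8"
    "(\<lambda>x. 1 - x + \<epsilon> * h x) has_fps_expansion E"
    "fps_deriv E = - (descent_egf y * E)"
    "\<And>x. x \<in> ball 0 2 \<Longrightarrow> norm (h x - ((1 + \<epsilon>) * (exp x - 1 - x
        - \<epsilon> * ((x * x - 2 * x + 2) * exp x / 2 - 1)) - x)) \<le> exp 8 * norm \<epsilon> ^ 2"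
proof -
  obtain \<omega> E where
    w: "\<omega> = fps_X * (1 + fps_const (2 - y) * \<omega> + fps_const (1 - y) * (\<omega> * \<omega>))" and
    dE: "fps_deriv E = - (descent_egf y * E)" and
    E: "E = borel_fps (1 - fps_const y * fps_X - fps_const (y * (1 - y)) * fps_X * \<omega>)"
    by (rule descent_egf_log_deriv)
  define c where "c = 1 - y"
  have c\<epsilon>: "c = - \<epsilon>" "norm c \<le> 1" "y = 1 + \<epsilon>"
    using assms by (simp_all add: c_def norm_minus_commute)
  have y2: "norm y \<le> 2" using norm_triangle_ineq[of 1 \<epsilon>] assms by (simp add: \<epsilon>_def)
  have "2 - y = 1 + c" by (simp add: c_def)
  then interpret motzkin_fps c \<omega>
    using w c\<epsilon>(2) by unfold_locales (simp_all add: c_def)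
  define K where "K = fps_const y * \<omega> - 1"
  define H where "H = borel_fps (fps_X * K)"
  have K: "wnorm N K \<le> 3" for N
  proof -
    have "wnorm N K \<le> norm y * wnorm N \<omega> + 1"
      using wnorm_add[of N "fps_const y * \<omega>" "-1"] by (simp add: K_def wnorm_const_mult)
    also have "\<dots> \<le> 2 * 1 + 1" by (intro add_mono mult_mono y2 wnorm_omega) auto
    finally show ?thesis by simp
  qed
  have XK: "wnorm N (fps_X * K) \<le> 3" for N
    using wnorm_X[of N K] K[of N] by simp
  note HK = borel_fps_wnorm_bound[of _ 3, OF K] borel_fps_wnorm_bound[of _ 3, OF XK, folded H_def]
  have e8: "3 * exp (4 * norm x) \<le> 3 * exp 8" if "x \<in> ball 0 2" for x :: complex
    using that by simp
  define h where "h = eval_fps H"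
  have h1: "h holomorphic_on ball 0 2"
    unfolding h_def by (rule holomorphic_on_eval_fps) (simp add: HK(3))
  have h2: "norm (h x) \<le> 3 * exp 8" if "x \<in> ball 0 2" for x
    unfolding h_def using HK(4)[of x] e8[OF that] by linarith
  have h3: "norm (deriv h x) \<le> 3 * exp 8" if "x \<in> ball 0 2" for x
  proof -
    have D: "deriv h x = eval_fps (borel_fps K) x"
      unfolding h_def using eval_fps_deriv[of x H] HK(3) by (simp add: H_def fps_deriv_borel_fps)
    show ?thesis unfolding D using HK(2)[of x] e8[OF that] by linarith
  qed
  have h4: "(\<lambda>x. 1 - x + \<epsilon> * h x) has_fps_expansion E"
  proof -
    have arg: "(1 - fps_const y * fps_X - fps_const (y * (1 - y)) * fps_X * \<omega>)
      = 1 - fps_X + fps_const \<epsilon> * (fps_X * K)"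
    proof -
      define Y where "Y = fps_const y"
      have e: "fps_const \<epsilon> = Y - 1" "fps_const (y * (1 - y)) = Y * (1 - Y)"
        by (simp_all add: Y_def \<epsilon>_def fps_eq_iff)
      show ?thesis unfolding e K_def Y_def[symmetric] by (simp add: algebra_simps)
    qed
    have "E = 1 - fps_X + fps_const \<epsilon> * H"
      unfolding E arg by (simp add: borel_fps_add borel_fps_diff borel_fps_const_mult H_def)
    moreover have "h has_fps_expansion H"
      unfolding h_def by (rule eval_fps_has_fps_expansion) (simp add: HK(3))
    ultimately show ?thesis by (auto intro!: fps_expansion_intros)
  qed
  define R where "R = borel_fps (fps_X * (\<delta> - \<delta>0))"
  have XR: "wnorm N (fps_X * (\<delta> - \<delta>0)) \<le> norm c / 2" for N
    using wnorm_X[of N "\<delta> - \<delta>0"] wnorm_delta_diff[of N] by simp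
  note R = borel_fps_wnorm_bound[of _ "norm c / 2", OF XR, folded R_def]
  define M where "M = (fps_exp 1 - 1 - fps_X) + fps_const c * (fps_const (1/2) * ((fps_X * fps_X - 2 * fps_X + 2) * fps_exp 1) - 1)"
  have H_eq: "H = fps_const y * (M + fps_const c * R) - fps_X"
  proof -
    have "fps_X * K = fps_const y * (fps_X * \<omega>0 + fps_const c * (fps_X * \<delta>0) + fps_const c * (fps_X * (\<delta> - \<delta>0))) - fps_X"
      unfolding K_def by (subst omega_eq) (simp add: algebra_simps)
    then show ?thesis
      unfolding H_def M_def R_def borel_fps_delta0[symmetric] borel_fps_omega0[symmetric]
      by (simp add: borel_fps_add borel_fps_diff borel_fps_const_mult)
  qed
  have rad: "fps_conv_radius M = \<infinity>" "fps_conv_radius (fps_const c * R) = \<infinity>"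
    unfolding M_def by (intro entire_fps_closure; simp add: R)+
  have h5: "norm (h x - ((1 + \<epsilon>) * (exp x - 1 - x
        - \<epsilon> * ((x * x - 2 * x + 2) * exp x / 2 - 1)) - x)) \<le> exp 8 * norm \<epsilon> ^ 2" if x: "x \<in> ball 0 2" for x
  proof -
    have M: "eval_fps M x = exp x - 1 - x - \<epsilon> * ((x * x - 2 * x + 2) * exp x / 2 - 1)"
      unfolding M_def c\<epsilon>(1)
      by (simp add: eval_fps_add eval_fps_diff eval_fps_mult entire_fps_closure)
    have "h x = y * (eval_fps M x + c * eval_fps R x) - x"
      unfolding h_def H_eq
      by (simp add: eval_fps_add eval_fps_diff eval_fps_mult entire_fps_closure rad R)
    then have "h x - (y * eval_fps M x - x) = y * (c * eval_fps R x)"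
      by (simp add: algebra_simps)
    then have "norm (h x - (y * eval_fps M x - x)) = norm y * (norm c * norm (eval_fps R x))"
      by (simp add: norm_mult)
    \<comment> \<open>The factors are \<open>norm y \<le> 2\<close>, the explicit \<open>c\<close>,
      and the bound \<open>norm c / 2\<close> for the weighted norm of
      \<open>X (\<delta> - \<delta>0)\<close>.\<close>
    also have "\<dots> \<le> 2 * (norm c * (norm c / 2 * exp 8))"
    proof (intro mult_mono y2 order_refl)
      show "norm (eval_fps R x) \<le> norm c / 2 * exp 8"
        using R(2)[of x] mult_left_mono[of "exp (4 * norm x)" "exp 8" "norm c / 2"] x by simp
    qed auto
    also have "\<dots> = exp 8 * norm \<epsilon> ^ 2"
      by (simp add: c\<epsilon>(1) power2_eq_square)
    finally show ?thesis unfolding M c\<epsilon>(3) .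
  qed
  show thesis by (rule that[OF h1 h2 h3 h4 dE h5])
qed

subsection \<open>Expansion of the dominant zero\<close>

text \<open>The elementary approximation of \<open>h\<close> from
  \<open>descent_egf_perturbation\<close>, with an error of order
  \<open>\<epsilon>\<^sup>2\<close>.\<close>

definition perturbation :: "complex \<Rightarrow> complex \<Rightarrow> complex" where
  "perturbation \<epsilon> x = (1 + \<epsilon>) * (exp x - 1 - x - \<epsilon> * ((x * x - 2 * x + 2) * exp x / 2 - 1)) - x"

lemma descent_egf_dominant_singularity:
  obtains \<rho> :: "complex \<Rightarrow> complex" and \<eta> C :: real where "\<eta> > 0"
    "\<And>\<epsilon>. norm \<epsilon> < \<eta> \<Longrightarrow> norm (\<rho> \<epsilon> - 1) \<le> C * norm \<epsilon>"
    "\<And>\<epsilon>. norm \<epsilon> < \<eta> \<Longrightarrow> norm (\<rho> \<epsilon> - 1 - \<epsilon> * perturbation \<epsilon> (\<rho> \<epsilon>)) \<le> C * norm \<epsilon> ^ 3"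
    "\<And>\<epsilon> n. norm \<epsilon> < \<eta> \<Longrightarrow>
      norm (fps_nth (descent_egf (1 + \<epsilon>)) n - (1 / \<rho> \<epsilon>) ^ Suc n) \<le> real (Suc n) * (2/3) ^ Suc n"
proof -
  define C :: real where "C = 3 * exp 8"
  have C1: "C \<ge> 1" using one_le_exp_iff[of "8 :: real"] unfolding C_def by linarith
  \<comment> \<open>Chosen so that \<open>norm \<epsilon> * C \<le> 1/8\<close>, as
    \<open>simple_zero_coeff_asymptotics\<close> requires.\<close>
  define \<eta> where "\<eta> = 1 / (8 * C)"
  have "\<exists>r. norm (r - 1) \<le> C * norm \<epsilon> \<and> norm (r - 1 - \<epsilon> * perturbation \<epsilon> r) \<le> C * norm \<epsilon> ^ 3 \<and>
      (\<forall>n. norm (fps_nth (descent_egf (1 + \<epsilon>)) n - (1 / r) ^ Suc n) \<le> real (Suc n) * (2/3) ^ Suc n)"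
    if \<epsilon>: "norm \<epsilon> < \<eta>" for \<epsilon>
  proof -
    have "norm \<epsilon> * C \<le> 1/8" using \<epsilon> C1 by (simp add: \<eta>_def field_simps)
    moreover have "norm \<epsilon> * 1 \<le> norm \<epsilon> * C" using C1 by (intro mult_left_mono) auto
    ultimately have \<epsilon>C: "norm \<epsilon> * C \<le> 1/8" "norm (1 + \<epsilon> - 1) \<le> 1" by auto
    obtain h E where h:
      "h holomorphic_on ball 0 2"
      "\<And>x. x \<in> ball 0 2 \<Longrightarrow> norm (h x) \<le> C"
      "\<And>x. x \<in> ball 0 2 \<Longrightarrow> norm (deriv h x) \<le> C"
      "(\<lambda>x. 1 - x + \<epsilon> * h x) has_fps_expansion E"
      "fps_deriv E = - (descent_egf (1 + \<epsilon>) * E)"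
      "\<And>x. x \<in> ball 0 2 \<Longrightarrow> norm (h x - perturbation \<epsilon> x) \<le> exp 8 * norm \<epsilon> ^ 2"
      by (rule descent_egf_perturbation[OF \<epsilon>C(2), unfolded add_diff_cancel_left',
        folded perturbation_def C_def]) (rule that)
    obtain r where r: "r = 1 + \<epsilon> * h r" "norm (r - 1) \<le> 1/8"
      "\<And>n. norm (fps_nth (descent_egf (1 + \<epsilon>)) n - (1 / r) ^ Suc n) \<le> real (Suc n) * (2/3) ^ Suc n"
      by (rule simple_zero_coeff_asymptotics[OF h(1,2,3) \<epsilon>C(1) h(4,5)]) (assumption+, rule that)
    have rS: "r \<in> ball 0 2" using r(2) norm_triangle_ineq[of "r - 1" 1] by simp
    have eq: "r - 1 = \<epsilon> * h r" by (subst (1) r(1)) simp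
    have "norm (r - 1) \<le> C * norm \<epsilon>"
      unfolding eq norm_mult using mult_left_mono[OF h(2)[OF rS], of "norm \<epsilon>"] by (simp add: mult.commute)
    moreover have "norm (r - 1 - \<epsilon> * perturbation \<epsilon> r) \<le> C * norm \<epsilon> ^ 3"
    proof -
      have "norm (r - 1 - \<epsilon> * perturbation \<epsilon> r) = norm \<epsilon> * norm (h r - perturbation \<epsilon> r)"
        unfolding eq by (simp add: norm_mult[symmetric] right_diff_distrib)
      also have "\<dots> \<le> norm \<epsilon> * (C * norm \<epsilon> ^ 2)"
        using h(6)[OF rS] by (intro mult_left_mono) (auto simp: C_def intro: order_trans)
      finally show ?thesis by (simp add: power3_eq_cube power2_eq_square mult_ac)
    qed
    ultimately show ?thesis using r(3) by blast
  qed
  then obtain \<rho> where "\<And>\<epsilon>. norm \<epsilon> < \<eta> \<Longrightarrow>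
      norm (\<rho> \<epsilon> - 1) \<le> C * norm \<epsilon> \<and> norm (\<rho> \<epsilon> - 1 - \<epsilon> * perturbation \<epsilon> (\<rho> \<epsilon>)) \<le> C * norm \<epsilon> ^ 3 \<and>
      (\<forall>n. norm (fps_nth (descent_egf (1 + \<epsilon>)) n - (1 / \<rho> \<epsilon>) ^ Suc n) \<le> real (Suc n) * (2/3) ^ Suc n)"
    by metis
  moreover have "\<eta> > 0" using C1 by (simp add: \<eta>_def)
  ultimately show thesis using that by blast
qed

text \<open>The first order is \<open>perturbation 0 1 = e - 3\<close>. At second order,
  \<open>perturbation 0 x = exp x - 1 - 2 x\<close> has slope \<open>e - 2\<close> at 1, which
  multiplies the shift \<open>e - 3\<close>; the \<open>\<epsilon>\<close>-derivative of
  \<open>perturbation\<close> at \<open>x = 1\<close> adds \<open>(e - 2) / 2\<close>.\<close>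

lemma root_expansion:
  fixes \<rho> :: "complex \<Rightarrow> complex" and C \<eta> :: real
  assumes \<eta>: "\<eta> > 0"
    and \<rho>1: "\<And>\<epsilon>. norm \<epsilon> < \<eta> \<Longrightarrow> norm (\<rho> \<epsilon> - 1) \<le> C * norm \<epsilon>"
    and \<rho>2: "\<And>\<epsilon>. norm \<epsilon> < \<eta> \<Longrightarrow> norm (\<rho> \<epsilon> - 1 - \<epsilon> * perturbation \<epsilon> (\<rho> \<epsilon>)) \<le> C * norm \<epsilon> ^ 3"
  defines "e \<equiv> exp 1 :: complex"
  shows "(\<rho> \<longlongrightarrow> 1) (at 0)"
    and "((\<lambda>\<epsilon>. (\<rho> \<epsilon> - 1 - (e - 3) * \<epsilon>) / \<epsilon>\<^sup>2) \<longlongrightarrow> (e - 2) * (e - 3) + (e - 2) / 2) (at 0)"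
proof -
  have ev: "eventually (\<lambda>\<epsilon>::complex. norm \<epsilon> < \<eta> \<and> \<epsilon> \<noteq> 0) (at 0)"
    unfolding eventually_at using \<eta> by (intro exI[of _ \<eta>]) auto
  have "((\<lambda>\<epsilon>. \<rho> \<epsilon> - 1) \<longlongrightarrow> 0) (at 0)"
  proof (rule Lim_null_comparison)
    show "eventually (\<lambda>\<epsilon>. norm (\<rho> \<epsilon> - 1) \<le> C * norm \<epsilon>) (at 0)"
      using ev by eventually_elim (use \<rho>1 in auto)
    show "((\<lambda>\<epsilon>::complex. C * norm \<epsilon>) \<longlongrightarrow> 0) (at 0)"
      by (auto intro!: tendsto_eq_intros)
  qed
  then show \<rho>: "(\<rho> \<longlongrightarrow> 1) (at 0)" by (simp add: Lim_null[symmetric])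
  define r where "r = (\<lambda>\<epsilon>. (\<rho> \<epsilon> - 1 - \<epsilon> * perturbation \<epsilon> (\<rho> \<epsilon>)) / \<epsilon>\<^sup>2)"
  have r0: "(r \<longlongrightarrow> 0) (at 0)"
  proof (rule Lim_null_comparison)
    show "eventually (\<lambda>\<epsilon>. norm (r \<epsilon>) \<le> C * norm \<epsilon>) (at 0)"
      using ev
    proof eventually_elim
      case (elim \<epsilon>)
      then have "norm (\<rho> \<epsilon> - 1 - \<epsilon> * perturbation \<epsilon> (\<rho> \<epsilon>)) \<le> (C * norm \<epsilon>) * norm \<epsilon> ^ 2"
        using \<rho>2[of \<epsilon>] by (simp add: power3_eq_cube power2_eq_square mult_ac)
      then show ?case using elim unfolding r_def norm_divide norm_power
        by (subst pos_divide_le_eq) auto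
    qed
    show "((\<lambda>\<epsilon>::complex. C * norm \<epsilon>) \<longlongrightarrow> 0) (at 0)"
      by (auto intro!: tendsto_eq_intros)
  qed
  have pert: "((\<lambda>\<epsilon>. perturbation \<epsilon> (\<rho> \<epsilon>)) \<longlongrightarrow> e - 3) (at 0)"
    unfolding perturbation_def e_def by (auto intro!: tendsto_eq_intros \<rho>)
  have \<delta>: "((\<lambda>\<epsilon>. (\<rho> \<epsilon> - 1) / \<epsilon>) \<longlongrightarrow> e - 3) (at 0)"
  proof -
    have "((\<lambda>\<epsilon>. perturbation \<epsilon> (\<rho> \<epsilon>) + \<epsilon> * r \<epsilon>) \<longlongrightarrow> e - 3) (at 0)"
      by (auto intro!: tendsto_eq_intros pert r0)
    moreover have "eventually (\<lambda>\<epsilon>. perturbation \<epsilon> (\<rho> \<epsilon>) + \<epsilon> * r \<epsilon> = (\<rho> \<epsilon> - 1) / \<epsilon>) (at 0)"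
      using ev by eventually_elim (simp add: r_def field_simps power2_eq_square)
    ultimately show ?thesis by (rule Lim_transform_eventually)
  qed
  have "((\<lambda>x::complex. exp x - 1 - 2 * x) has_field_derivative (e - 2)) (at 1)"
    unfolding e_def by (auto intro!: derivative_eq_intros)
  \<comment> \<open>Caratheodory's form of the derivative: a slope function continuous at 1, which
    takes the place of a Taylor remainder.\<close>
  then obtain g where g: "\<And>x. (exp x - 1 - 2 * x) - (exp 1 - 1 - 2 * 1) = g x * (x - 1)"
    "isCont g (1::complex)" "g 1 = e - 2"
    unfolding CARAT_DERIV by blast
  define G where "G = (\<lambda>x::complex. (x * x - 2 * x + 2) * exp x / 2 - 1)"
  have g\<rho>: "((\<lambda>\<epsilon>. g (\<rho> \<epsilon>)) \<longlongrightarrow> e - 2) (at 0)"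
    using isCont_tendsto_compose[OF g(2) \<rho>] g(3) by simp
  have "((\<lambda>\<epsilon>. g (\<rho> \<epsilon>) * ((\<rho> \<epsilon> - 1) / \<epsilon>) + (exp (\<rho> \<epsilon>) - 1 - \<rho> \<epsilon> - G (\<rho> \<epsilon>)) - \<epsilon> * G (\<rho> \<epsilon>) + r \<epsilon>)
     \<longlongrightarrow> (e - 2) * (e - 3) + (e - 1 - 1 - (e / 2 - 1)) - 0 * (e / 2 - 1) + 0) (at 0)"
    unfolding G_def
    by (intro tendsto_intros g\<rho> \<delta> r0; (intro tendsto_eq_intros \<rho> refl)?) (auto simp: e_def intro!: tendsto_eq_intros \<rho>)
  moreover have "eventually (\<lambda>\<epsilon>. g (\<rho> \<epsilon>) * ((\<rho> \<epsilon> - 1) / \<epsilon>) + (exp (\<rho> \<epsilon>) - 1 - \<rho> \<epsilon> - G (\<rho> \<epsilon>)) - \<epsilon> * G (\<rho> \<epsilon>) + r \<epsilon>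
    = (\<rho> \<epsilon> - 1 - (e - 3) * \<epsilon>) / \<epsilon>\<^sup>2) (at 0)"
    using ev
  proof eventually_elim
    case (elim \<epsilon>)
    have "perturbation \<epsilon> (\<rho> \<epsilon>) = (exp (\<rho> \<epsilon>) - 1 - 2 * \<rho> \<epsilon> - (exp 1 - 1 - 2 * 1)) + (e - 3)
       + \<epsilon> * (exp (\<rho> \<epsilon>) - 1 - \<rho> \<epsilon> - G (\<rho> \<epsilon>)) - \<epsilon> * \<epsilon> * G (\<rho> \<epsilon>)"
    proof -
      have "perturbation \<epsilon> (\<rho> \<epsilon>) = (1 + \<epsilon>) * (exp (\<rho> \<epsilon>) - 1 - \<rho> \<epsilon> - \<epsilon> * G (\<rho> \<epsilon>)) - \<rho> \<epsilon>"
        by (simp add: perturbation_def G_def)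
      then show ?thesis by (simp add: e_def algebra_simps)
    qed
    then have P: "perturbation \<epsilon> (\<rho> \<epsilon>) = g (\<rho> \<epsilon>) * (\<rho> \<epsilon> - 1) + (e - 3)
       + \<epsilon> * (exp (\<rho> \<epsilon>) - 1 - \<rho> \<epsilon> - G (\<rho> \<epsilon>)) - \<epsilon> * \<epsilon> * G (\<rho> \<epsilon>)"
      unfolding g(1) .
    define X where "X = \<rho> \<epsilon> - 1"
    define K where "K = exp (\<rho> \<epsilon>) - 1 - \<rho> \<epsilon> - G (\<rho> \<epsilon>)"
    have "X = \<epsilon> * perturbation \<epsilon> (\<rho> \<epsilon>) + \<epsilon>\<^sup>2 * r \<epsilon>"
      using elim by (simp add: r_def X_def)
    then have "X - (e - 3) * \<epsilon> = \<epsilon> * (perturbation \<epsilon> (\<rho> \<epsilon>) - (e - 3)) + \<epsilon>\<^sup>2 * r \<epsilon>"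
      by (simp add: algebra_simps)
    also have "perturbation \<epsilon> (\<rho> \<epsilon>) - (e - 3) = g (\<rho> \<epsilon>) * X + \<epsilon> * K - \<epsilon> * \<epsilon> * G (\<rho> \<epsilon>)"
      unfolding P X_def K_def by simp
    also have "\<epsilon> * \<dots> + \<epsilon>\<^sup>2 * r \<epsilon> = \<epsilon>\<^sup>2 * (g (\<rho> \<epsilon>) * (X / \<epsilon>) + K - \<epsilon> * G (\<rho> \<epsilon>) + r \<epsilon>)"
      using elim by (simp add: field_simps power2_eq_square)
    finally have "(X - (e - 3) * \<epsilon>) / \<epsilon>\<^sup>2 =
        g (\<rho> \<epsilon>) * (X / \<epsilon>) + K - \<epsilon> * G (\<rho> \<epsilon>) + r \<epsilon>"
      using elim by simp
    then show ?case unfolding X_def K_def by simp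
  qed
  ultimately have "((\<lambda>\<epsilon>. (\<rho> \<epsilon> - 1 - (e - 3) * \<epsilon>) / \<epsilon>\<^sup>2) \<longlongrightarrow>
      (e - 2) * (e - 3) + (e - 1 - 1 - (e / 2 - 1)) - 0 * (e / 2 - 1) + 0) (at 0)"
    by (rule Lim_transform_eventually)
  also have "(e - 2) * (e - 3) + (e - 1 - 1 - (e / 2 - 1)) - 0 * (e / 2 - 1) + 0 = (e - 2) * (e - 3) + (e - 2) / 2"
    by (simp add: field_simps)
  finally show "((\<lambda>\<epsilon>. (\<rho> \<epsilon> - 1 - (e - 3) * \<epsilon>) / \<epsilon>\<^sup>2) \<longlongrightarrow> (e - 2) * (e - 3) + (e - 2) / 2) (at 0)" .
qed

section \<open>Limits under the substitution \<open>y = exp z\<close>\<close>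

lemma exp_second_order_quotient:
  "((\<lambda>z::complex. (exp z - 1 - z) / z\<^sup>2) \<longlongrightarrow> 1/2) (at 0)"
proof (rule LIM_offset_zero_cancel, rule iffD2[OF Lim_null], simp, rule Lim_null_comparison)
  show "((\<lambda>z::complex. exp (norm z) * norm z / 2) \<longlongrightarrow> 0) (at 0)"
    by (auto intro!: tendsto_eq_intros)
  show "eventually (\<lambda>z::complex. norm ((exp z - 1 - z) / z\<^sup>2 - 1/2) \<le> exp (norm z) * norm z / 2) (at 0)"
    unfolding eventually_at
  proof (intro exI[of _ 1] conjI ballI impI)
    fix z :: complex assume "z \<noteq> 0 \<and> dist z 0 < 1"
    then have z: "z \<noteq> 0" by simp
    have "norm (exp z - (\<Sum>i\<le>2. z ^ i / fact i)) \<le> exp (norm z) * (norm z ^ Suc 2) / fact 2"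
      by (rule Taylor_exp_field)
    also have "exp z - (\<Sum>i\<le>2. z ^ i / fact i) = ((exp z - 1 - z) / z\<^sup>2 - 1/2) * z\<^sup>2"
      using z by (simp add: numeral_2_eq_2 field_simps)
    finally have "norm ((exp z - 1 - z) / z\<^sup>2 - 1/2) * norm z ^ 2 \<le> (exp (norm z) * norm z / 2) * norm z ^ 2"
      unfolding norm_mult norm_power by (simp add: power2_eq_square numeral_2_eq_2 mult_ac)
    then show "norm ((exp z - 1 - z) / z\<^sup>2 - 1/2) \<le> exp (norm z) * norm z / 2"
      by (rule mult_right_le_imp_le) (use z in simp)
  qed simp
qed

text \<open>Write the power as \<open>exp (n * Ln (f n))\<close> and use
  \<open>Ln z = g z * (z - 1)\<close> with \<open>g\<close> continuous at 1 and
  \<open>g 1 = 1\<close>.\<close>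

lemma tendsto_power_exp:
  fixes f :: "nat \<Rightarrow> complex"
  assumes "(\<lambda>n. of_nat n * (f n - 1)) \<longlonglongrightarrow> a" "f \<longlonglongrightarrow> 1"
  shows "(\<lambda>n. f n ^ n) \<longlonglongrightarrow> exp a"
proof -
  have "(Ln has_field_derivative 1) (at 1)"
    by (auto intro!: derivative_eq_intros)
  then obtain g where g: "\<And>z. Ln z - Ln 1 = g z * (z - 1)" "isCont g 1" "g 1 = 1"
    unfolding CARAT_DERIV by blast
  have "(\<lambda>n. exp (g (f n) * (of_nat n * (f n - 1)))) \<longlonglongrightarrow> exp (1 * a)"
    using isCont_tendsto_compose[OF g(2) assms(2)] g(3) by (intro tendsto_intros assms) auto
  moreover have "eventually (\<lambda>n. exp (g (f n) * (of_nat n * (f n - 1))) = f n ^ n) sequentially"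
    using tendsto_imp_eventually_ne[OF assms(2), of 0, simplified]
  proof eventually_elim
    case (elim n)
    have "g (f n) * (of_nat n * (f n - 1)) = of_nat n * (g (f n) * (f n - 1))"
      by (simp only: mult.left_commute)
    also have "\<dots> = of_nat n * Ln (f n)" using g(1)[of "f n"] by simp
    finally have "exp (g (f n) * (of_nat n * (f n - 1))) = exp (of_nat n * Ln (f n))" by (rule arg_cong)
    also have "\<dots> = f n ^ n" using elim by (simp add: exp_of_nat_mult)
    finally show ?case .
  qed
  ultimately show ?thesis by (auto intro: Lim_transform_eventually)
qed

text \<open>The factor \<open>exp (\<mu> * z)\<close> centres the variable and cancels the linear
  term. The \<open>z\<^sup>2\<close> coefficient collects \<open>\<beta>\<close>,
  \<open>- \<mu> / 2\<close> from \<open>exp z - 1\<close>, \<open>- \<mu>\<^sup>2\<close> from the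
  cross term, and \<open>\<mu>\<^sup>2 / 2\<close> from the centring factor.\<close>

lemma normalized_root_quotient:
  fixes \<rho> :: "complex \<Rightarrow> complex" and \<mu> \<beta> :: complex
  assumes \<rho>: "((\<lambda>\<epsilon>. (\<rho> \<epsilon> - 1 + \<mu> * \<epsilon>) / \<epsilon>\<^sup>2) \<longlongrightarrow> \<beta>) (at 0)"
  shows "((\<lambda>z. (\<rho> (exp z - 1) * exp (\<mu> * z) - 1) / z\<^sup>2) \<longlongrightarrow> \<beta> - (\<mu> + \<mu>\<^sup>2) / 2) (at 0)"
proof -
  define A where "A = (\<lambda>z::complex. (exp z - 1 - z) / z\<^sup>2)"
  have A: "(A \<longlongrightarrow> 1/2) (at 0)" unfolding A_def by (rule exp_second_order_quotient)
  have expA: "exp z = 1 + z + z\<^sup>2 * A z" for z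
    by (cases "z = 0") (auto simp: A_def)
  \<comment> \<open>The continuous extension of \<open>A\<close> to 0; with it the limit of
    \<open>B (a * z)\<close> holds for every \<open>a\<close>, including 0.\<close>
  define B where "B = (\<lambda>z::complex. if z = 0 then 1/2 else A z)"
  have "(B \<longlongrightarrow> 1/2) (at 0)"
    using A by (rule Lim_transform_eventually) (auto simp: B_def eventually_at_filter)
  then have isB: "isCont B 0" by (simp add: isCont_def B_def)
  have expB: "exp z = 1 + z + z\<^sup>2 * B z" for z
    using expA[of z] by (auto simp: B_def)
  have B: "((\<lambda>z. B (a * z)) \<longlongrightarrow> 1/2) (at 0)" for a
  proof -
    have "((\<lambda>z. a * z) \<longlongrightarrow> 0) (at 0)" by (auto intro!: tendsto_eq_intros)
    from isCont_tendsto_compose[OF isB this] show ?thesis by (simp add: B_def)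
  qed
  define q where "q = (\<lambda>\<epsilon>. (\<rho> \<epsilon> - 1 + \<mu> * \<epsilon>) / \<epsilon>\<^sup>2)"
  \<comment> \<open>The hypothesis is a limit at the punctured point, so \<open>exp z - 1\<close>
    must also be nonzero for small nonzero \<open>z\<close>.\<close>
  have lim: "filterlim (\<lambda>z::complex. exp z - 1) (at 0) (at 0)"
  proof (rule filterlim_atI)
    show "((\<lambda>z::complex. exp z - 1) \<longlongrightarrow> 0) (at 0)" by (auto intro!: tendsto_eq_intros)
    have "((\<lambda>z. 1 + z * B (1 * z)) \<longlongrightarrow> 1 + 0 * (1/2)) (at 0)" by (intro tendsto_intros B)
    then have "eventually (\<lambda>z. 1 + z * B (1 * z) \<noteq> 0) (at 0)"
      by (rule tendsto_imp_eventually_ne) auto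
    moreover have "eventually (\<lambda>z::complex. z \<noteq> 0) (at 0)" by (auto simp: eventually_at_filter)
    ultimately show "eventually (\<lambda>z::complex. exp z - 1 \<noteq> 0) (at 0)"
    proof eventually_elim
      case (elim z)
      have "exp z - 1 = z * (1 + z * B (1 * z))"
        by (subst expB) (simp add: algebra_simps power2_eq_square)
      then show ?case using elim by simp
    qed
  qed
  have q: "((\<lambda>z. q (exp z - 1)) \<longlongrightarrow> \<beta>) (at 0)"
    using filterlim_compose[OF \<rho> lim] by (simp add: q_def)
  \<comment> \<open>The quotient expanded exactly, after replacing both exponentials by
    \<open>1 + w + w\<^sup>2 * B w\<close>.\<close>
  let ?L = "\<lambda>z. - \<mu> * B (1 * z) + \<mu>\<^sup>2 * B (\<mu> * z) - \<mu>\<^sup>2 - \<mu>\<^sup>2 * z * B (1 * z) - \<mu> ^ 3 * z * B (\<mu> * z)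
     - \<mu> ^ 3 * z\<^sup>2 * B (1 * z) * B (\<mu> * z) + q (exp z - 1) * (1 + z * B (1 * z))\<^sup>2 * exp (\<mu> * z)"
  have "(?L \<longlongrightarrow> - \<mu> * (1/2) + \<mu>\<^sup>2 * (1/2) - \<mu>\<^sup>2 - \<mu>\<^sup>2 * 0 * (1/2) - \<mu> ^ 3 * 0 * (1/2)
     - \<mu> ^ 3 * 0\<^sup>2 * (1/2) * (1/2) + \<beta> * (1 + 0 * (1/2))\<^sup>2 * exp (\<mu> * 0)) (at 0)"
    by (intro tendsto_intros B q)
  moreover have "eventually (\<lambda>z. ?L z = (\<rho> (exp z - 1) * exp (\<mu> * z) - 1) / z\<^sup>2) (at 0)"
  proof -
    have "eventually (\<lambda>z::complex. z \<noteq> 0) (at 0)" by (auto simp: eventually_at_filter)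
    moreover have "eventually (\<lambda>z::complex. exp z - 1 \<noteq> 0) (at 0)"
      using lim unfolding filterlim_at by simp
    ultimately show ?thesis
    proof eventually_elim
      case (elim z)
      define b b' where "b = B z" and "b' = B (\<mu> * z)"
      have e: "exp z = 1 + z + z\<^sup>2 * b" using expB[of z] by (simp add: b_def)
      have e': "exp (\<mu> * z) = 1 + \<mu> * z + (\<mu> * z)\<^sup>2 * b'" using expB[of "\<mu> * z"] by (simp add: b'_def)
      define u where "u = exp z - 1"
      have u: "u = z * (1 + z * b)" unfolding u_def e by (simp add: algebra_simps power2_eq_square)
      have u0: "u \<noteq> 0" using elim by (simp add: u_def)
      have "q u * u\<^sup>2 = \<rho> u - 1 + \<mu> * u" using u0 by (simp add: q_def)
      then have "\<rho> u = 1 - \<mu> * u + q u * u\<^sup>2" by simp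
      then have "\<rho> u * exp (\<mu> * z) - 1 = ((1 - \<mu> * u) * exp (\<mu> * z) - 1) + q u * u\<^sup>2 * exp (\<mu> * z)"
        by (simp add: distrib_right)
      also have "(1 - \<mu> * u) * exp (\<mu> * z) - 1 = z\<^sup>2 * (- \<mu> * b + \<mu>\<^sup>2 * b' - \<mu>\<^sup>2 - \<mu>\<^sup>2 * z * b - \<mu> ^ 3 * z * b'
          - \<mu> ^ 3 * z\<^sup>2 * b * b')"
        unfolding e' u by (simp add: algebra_simps power2_eq_square power3_eq_cube)
      also have "q u * u\<^sup>2 * exp (\<mu> * z) = z\<^sup>2 * (q u * (1 + z * b)\<^sup>2 * exp (\<mu> * z))"
      proof -
        have "u\<^sup>2 = z\<^sup>2 * (1 + z * b)\<^sup>2" unfolding u by (simp add: power_mult_distrib)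
        then show ?thesis by (simp only: mult_ac)
      qed
      finally have "(\<rho> u * exp (\<mu> * z) - 1) / z\<^sup>2 = - \<mu> * b + \<mu>\<^sup>2 * b' - \<mu>\<^sup>2 - \<mu>\<^sup>2 * z * b - \<mu> ^ 3 * z * b'
          - \<mu> ^ 3 * z\<^sup>2 * b * b' + q u * (1 + z * b)\<^sup>2 * exp (\<mu> * z)"
        using elim(1) unfolding distrib_left[of "z\<^sup>2", symmetric] by simp
      then show ?case unfolding mult_1_left u_def b_def b'_def by (rule sym)
    qed
  qed
  ultimately have "((\<lambda>z. (\<rho> (exp z - 1) * exp (\<mu> * z) - 1) / z\<^sup>2) \<longlongrightarrow>
     - \<mu> * (1/2) + \<mu>\<^sup>2 * (1/2) - \<mu>\<^sup>2 - \<mu>\<^sup>2 * 0 * (1/2) - \<mu> ^ 3 * 0 * (1/2)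
     - \<mu> ^ 3 * 0\<^sup>2 * (1/2) * (1/2) + \<beta> * (1 + 0 * (1/2))\<^sup>2 * exp (\<mu> * 0)) (at 0)"
    by (rule Lim_transform_eventually)
  also have "- \<mu> * (1/2) + \<mu>\<^sup>2 * (1/2) - \<mu>\<^sup>2 - \<mu>\<^sup>2 * 0 * (1/2) - \<mu> ^ 3 * 0 * (1/2)
     - \<mu> ^ 3 * 0\<^sup>2 * (1/2) * (1/2) + \<beta> * (1 + 0 * (1/2))\<^sup>2 * exp (\<mu> * 0) = \<beta> - (\<mu> + \<mu>\<^sup>2) / 2"
    by (simp add: add_divide_distrib)
  finally show ?thesis .
qed

subsection \<open>Convergence in distribution\<close>

text \<open>The centred normal law is the image of the standard one under scaling by
  \<open>\<sigma>\<close>.\<close>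

lemma char_normal_distribution:
  assumes \<sigma>: "\<sigma> > 0"
  shows "real_distribution (density lborel (normal_density 0 \<sigma>))"
    and "char (density lborel (normal_density 0 \<sigma>)) t = complex_of_real (exp (- (\<sigma> * t)\<^sup>2 / 2))"
proof -
  interpret N: real_distribution std_normal_distribution by (rule real_dist_normal_dist)
  have "distributed std_normal_distribution lborel (\<lambda>x. x) (normal_density 0 1)"
    unfolding distributed_def by (auto simp: distr_id2)
  from N.normal_density_affine[OF this, of \<sigma> 0] \<sigma>
  have "distributed std_normal_distribution lborel (\<lambda>x. \<sigma> * x) (normal_density 0 \<sigma>)"
    by simp
  then have "density lborel (normal_density 0 \<sigma>) = distr std_normal_distribution lborel (\<lambda>x. \<sigma> * x)"
    by (rule distributed_distr_eq_density[symmetric])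
  also have "\<dots> = distr std_normal_distribution borel (\<lambda>x. \<sigma> * x)"
    by (rule distr_cong) auto
  finally have D: "density lborel (normal_density 0 \<sigma>) = distr std_normal_distribution borel (\<lambda>x. \<sigma> * x)" .
  show "real_distribution (density lborel (normal_density 0 \<sigma>))"
    unfolding D by (rule N.real_distribution_distr) simp
  have "char (distr std_normal_distribution borel (\<lambda>x. \<sigma> * x)) t = char std_normal_distribution (\<sigma> * t)"
    unfolding char_def by (subst integral_distr) (auto simp: mult_ac)
  then show "char (density lborel (normal_density 0 \<sigma>)) t = complex_of_real (exp (- (\<sigma> * t)\<^sup>2 / 2))"
    unfolding D char_std_normal_distribution .
qed

text \<open>Averaging \<open>exp z\<close> to the power \<open>des + 1\<close> over permutations
  gives the coefficient of \<open>descent_egf\<close>; the centring is a deterministic factor. At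
  \<open>n = 0\<close> both sides are 1, because division by 0 yields 0.\<close>

lemma char_normalized_descents:
  fixes t \<mu> :: real and n :: nat
  defines "z \<equiv> \<i> * complex_of_real (t / sqrt (real n))"
  shows "char (distr (measure_pmf (pmf_of_set (permutations_of_set {1..n}))) borel
       (\<lambda>\<pi>. (real (des (stack_sort \<pi>)) + 1 - \<mu> * real n) / sqrt (real n))) t
    = fps_nth (descent_egf (exp z)) n * exp (- (complex_of_real \<mu> * z * of_nat n))"
proof -
  let ?S = "permutations_of_set {1..n}"
  let ?X = "\<lambda>\<pi>. (real (des (stack_sort \<pi>)) + 1 - \<mu> * real n) / sqrt (real n)"
  have S: "finite ?S" "?S \<noteq> {}" "card ?S = fact n"
    by (auto simp: card_permutations_of_set)
  have "char (distr (measure_pmf (pmf_of_set ?S)) borel ?X) t = (LINT \<pi>|measure_pmf (pmf_of_set ?S). iexp (t * ?X \<pi>))"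
    unfolding char_def by (subst integral_distr) auto
  also have "\<dots> = (\<Sum>\<pi>\<in>?S. pmf (pmf_of_set ?S) \<pi> *\<^sub>R iexp (t * ?X \<pi>))"
    by (rule integral_measure_pmf) (use S in auto)
  also have "\<dots> = (\<Sum>\<pi>\<in>?S. exp z ^ Suc (des (stack_sort \<pi>)) * exp (- (complex_of_real \<mu> * z * of_nat n)) / fact n)"
  proof (intro sum.cong refl)
    fix \<pi> assume \<pi>: "\<pi> \<in> ?S"
    let ?d = "des (stack_sort \<pi>)"
    have "iexp (t * ?X \<pi>) = exp (of_nat (Suc ?d) * z + - (complex_of_real \<mu> * z * of_nat n))"
      by (rule arg_cong[where f = exp]) (simp add: z_def diff_divide_distrib add_divide_distrib algebra_simps)
    also have "\<dots> = exp z ^ Suc ?d * exp (- (complex_of_real \<mu> * z * of_nat n))"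
      by (simp only: exp_add exp_of_nat_mult)
    finally show "pmf (pmf_of_set ?S) \<pi> *\<^sub>R iexp (t * ?X \<pi>) =
       exp z ^ Suc ?d * exp (- (complex_of_real \<mu> * z * of_nat n)) / fact n"
      using S \<pi> by (simp add: scaleR_conv_of_real)
  qed
  also have "\<dots> = fps_nth (descent_egf (exp z)) n * exp (- (complex_of_real \<mu> * z * of_nat n))"
    unfolding descent_egf_nth by (simp add: sum_distrib_left sum_distrib_right sum_divide_distrib mult_ac)
  finally show ?thesis .
qed

text \<open>With \<open>f z = \<rho> (exp z - 1) * exp (\<mu> * z)\<close>, the expression is
  \<open>1 / \<rho>\<close> times \<open>1 / f (z n) ^ n\<close>, up to an exponentially small
  error. Since \<open>f z = 1 + s z\<^sup>2 + o(z\<^sup>2)\<close> and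
  \<open>n (z n)\<^sup>2 = - t\<^sup>2\<close>, the power tends to
  \<open>exp (- t\<^sup>2 s)\<close>, where \<open>s\<close> is minus half the variance.\<close>

lemma char_normalized_descents_tendsto:
  fixes t :: real
  assumes t: "t \<noteq> 0"
  defines "\<mu> \<equiv> 3 - exp 1 :: real"
  defines "z \<equiv> \<lambda>n::nat. \<i> * complex_of_real (t / sqrt (real n))"
  shows "(\<lambda>n. fps_nth (descent_egf (exp (z n))) n * exp (- (complex_of_real \<mu> * z n * of_nat n)))
    \<longlonglongrightarrow> exp (- complex_of_real ((2 + 2 * exp 1 - (exp 1)\<^sup>2) * t\<^sup>2 / 2))"
proof -
  obtain \<rho> \<eta> C where \<eta>: "\<eta> > 0" and
    \<rho>1: "\<And>\<epsilon>. norm \<epsilon> < \<eta> \<Longrightarrow> norm (\<rho> \<epsilon> - 1) \<le> C * norm \<epsilon>" and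
    \<rho>2: "\<And>\<epsilon>. norm \<epsilon> < \<eta> \<Longrightarrow> norm (\<rho> \<epsilon> - 1 - \<epsilon> * perturbation \<epsilon> (\<rho> \<epsilon>)) \<le> C * norm \<epsilon> ^ 3" and
    \<rho>3: "\<And>\<epsilon> n. norm \<epsilon> < \<eta> \<Longrightarrow>
      norm (fps_nth (descent_egf (1 + \<epsilon>)) n - (1 / \<rho> \<epsilon>) ^ Suc n) \<le> real (Suc n) * (2/3) ^ Suc n"
    by (rule descent_egf_dominant_singularity) (rule that)
  define e where "e = (exp 1 :: complex)"
  have e: "complex_of_real (exp 1) = e" using exp_of_real[of 1, where 'a = complex] by (simp add: e_def)
  have \<mu>: "complex_of_real \<mu> = 3 - e" by (simp add: \<mu>_def e)
  note exps = root_expansion[OF \<eta> \<rho>1 \<rho>2]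
  define f where "f = (\<lambda>z. \<rho> (exp z - 1) * exp (complex_of_real \<mu> * z))"
  define s where "s = - complex_of_real ((2 + 2 * exp 1 - (exp 1)\<^sup>2) / 2)"
  have f: "((\<lambda>z. (f z - 1) / z\<^sup>2) \<longlongrightarrow> s) (at 0)"
  proof -
    have "((\<lambda>\<epsilon>. (\<rho> \<epsilon> - 1 + complex_of_real \<mu> * \<epsilon>) / \<epsilon>\<^sup>2) \<longlongrightarrow> (e - 2) * (e - 3) + (e - 2) / 2) (at 0)"
      using exps(2) by (simp add: \<mu> e_def algebra_simps)
    from normalized_root_quotient[OF this]
    have "((\<lambda>z. (f z - 1) / z\<^sup>2) \<longlongrightarrow> (e - 2) * (e - 3) + (e - 2) / 2
        - (complex_of_real \<mu> + (complex_of_real \<mu>)\<^sup>2) / 2) (at 0)"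
      by (simp only: f_def)
    also have "(e - 2) * (e - 3) + (e - 2) / 2 - (complex_of_real \<mu> + (complex_of_real \<mu>)\<^sup>2) / 2 = s"
    proof -
      have "2 * (A + B / 2 - D / 2) = 2 * A + B - D" for A B D :: complex
        by (simp add: algebra_simps)
      then have "2 * ((e - 2) * (e - 3) + (e - 2) / 2 - (complex_of_real \<mu> + (complex_of_real \<mu>)\<^sup>2) / 2)
          = 2 * ((e - 2) * (e - 3)) + (e - 2) - (complex_of_real \<mu> + (complex_of_real \<mu>)\<^sup>2)"
        by blast
      also have "\<dots> = - (2 + 2 * e - e\<^sup>2)"
        unfolding \<mu> by (simp add: algebra_simps power2_eq_square)
      also have "\<dots> = 2 * s"
      proof -
        have "complex_of_real (2 + 2 * exp 1 - (exp 1)\<^sup>2) = 2 + 2 * e - e\<^sup>2" by (simp add: e)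
        then have s: "s = - ((2 + 2 * e - e\<^sup>2) / 2)"
          unfolding s_def by (simp only: of_real_divide of_real_numeral)
        have "- A = 2 * - (A / 2)" for A :: complex by simp
        then show ?thesis unfolding s by blast
      qed
      finally show ?thesis by (rule mult_left_cancel[THEN iffD1, rotated]) simp
    qed
    finally show ?thesis .
  qed
  have z0: "z \<longlonglongrightarrow> 0"
  proof -
    have "(\<lambda>n. t / sqrt (real n)) \<longlonglongrightarrow> 0"
      by (rule tendsto_divide_0[OF tendsto_const])
        (auto intro!: filterlim_at_top_imp_at_infinity filterlim_compose[OF sqrt_at_top] filterlim_real_sequentially)
    then have "(\<lambda>n. \<i> * complex_of_real (t / sqrt (real n))) \<longlonglongrightarrow> \<i> * complex_of_real 0"
      by (intro tendsto_intros)
    then show ?thesis by (simp add: z_def)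
  qed
  have pos: "eventually (\<lambda>n::nat. n > 0) sequentially" by (rule eventually_gt_at_top)
  \<comment> \<open>Here \<open>t \<noteq> 0\<close> keeps \<open>z n\<close> away from 0, the
    excluded point of the limit \<open>f\<close>.\<close>
  have zat: "filterlim z (at 0) sequentially"
    by (rule filterlim_atI[OF z0]) (use pos in \<open>eventually_elim, simp add: z_def t\<close>)
  have n_lim: "(\<lambda>n. of_nat n * (f (z n) - 1)) \<longlonglongrightarrow> - (complex_of_real t)\<^sup>2 * s"
  proof (rule Lim_transform_eventually)
    show "(\<lambda>n. - (complex_of_real t)\<^sup>2 * ((f (z n) - 1) / (z n)\<^sup>2)) \<longlonglongrightarrow> - (complex_of_real t)\<^sup>2 * s"
      by (intro tendsto_intros filterlim_compose[OF f zat])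
    show "eventually (\<lambda>n. - (complex_of_real t)\<^sup>2 * ((f (z n) - 1) / (z n)\<^sup>2) = of_nat n * (f (z n) - 1)) sequentially"
      using pos
    proof eventually_elim
      case (elim n)
      have "(complex_of_real (sqrt (real n)))\<^sup>2 = of_nat n"
        by (simp flip: of_real_power)
      then have nz: "- (complex_of_real t)\<^sup>2 = of_nat n * (z n)\<^sup>2"
        using elim by (simp add: z_def power_mult_distrib power_divide)
      have "z n \<noteq> 0" using elim t by (simp add: z_def)
      then show ?case unfolding nz by simp
    qed
  qed
  have \<epsilon>0: "(\<lambda>n. exp (z n) - 1) \<longlonglongrightarrow> 0"
    using z0 by (auto intro!: tendsto_eq_intros)
  \<comment> \<open>The linear bound at \<open>\<epsilon> = 0\<close> fixes this value, so the limit
    of \<open>\<rho>\<close> at 0 becomes continuity there.\<close>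
  have "\<rho> 0 = 1" using \<rho>1[of 0] \<eta> by simp
  then have "isCont \<rho> 0" using exps(1) by (simp add: isCont_def)
  then have \<rho>lim: "(\<lambda>n. \<rho> (exp (z n) - 1)) \<longlonglongrightarrow> 1"
    using isCont_tendsto_compose[OF _ \<epsilon>0] \<open>\<rho> 0 = 1\<close> by metis
  have "(\<lambda>n. f (z n)) \<longlonglongrightarrow> 1 * exp (complex_of_real \<mu> * 0)"
    unfolding f_def by (intro tendsto_intros \<rho>lim z0)
  then have pow: "(\<lambda>n. f (z n) ^ n) \<longlonglongrightarrow> exp (- (complex_of_real t)\<^sup>2 * s)"
    by (intro tendsto_power_exp n_lim) simp
  define u where "u = (\<lambda>n. exp (- (complex_of_real \<mu> * z n * of_nat n)))"
  have u1: "norm (u n) = 1" for n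
  proof -
    have "Re (complex_of_real \<mu> * z n * of_nat n) = 0" by (simp add: z_def)
    then show ?thesis by (simp add: u_def norm_exp_eq_Re)
  qed
  let ?T = "\<lambda>n. fps_nth (descent_egf (exp (z n))) n"
  let ?r = "\<lambda>n. \<rho> (exp (z n) - 1)"
  \<comment> \<open>As \<open>z n\<close> is imaginary, \<open>u n\<close> has modulus 1 and the
    coefficient error stays exponentially small.\<close>
  have err: "(\<lambda>n. (?T n - (1 / ?r n) ^ Suc n) * u n) \<longlonglongrightarrow> 0"
  proof (rule Lim_null_comparison)
    have "eventually (\<lambda>n. norm (exp (z n) - 1) < \<eta>) sequentially"
      using tendstoD[OF \<epsilon>0 \<eta>] by simp
    then show "eventually (\<lambda>n. norm ((?T n - (1 / ?r n) ^ Suc n) * u n) \<le> real (Suc n) * (2/3) ^ Suc n) sequentially"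
    proof eventually_elim
      case (elim n)
      show ?case using \<rho>3[OF elim, of n] unfolding norm_mult u1 by simp
    qed
    show "(\<lambda>n. real (Suc n) * (2/3) ^ Suc n) \<longlonglongrightarrow> 0"
      by (rule LIMSEQ_Suc) (rule powser_times_n_limit_0, simp)
  qed
  have "(\<lambda>n. 1 / ?r n * (1 / f (z n) ^ n)) \<longlonglongrightarrow> 1 / 1 * (1 / exp (- (complex_of_real t)\<^sup>2 * s))"
    by (intro tendsto_intros \<rho>lim pow) auto
  moreover have "1 / ?r n * (1 / f (z n) ^ n) = (1 / ?r n) ^ Suc n * u n" for n
  proof -
    have "exp (complex_of_real \<mu> * z n) ^ n = exp (complex_of_real \<mu> * z n * of_nat n)"
      by (simp add: exp_of_nat_mult[symmetric] mult.commute)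
    then show ?thesis
      by (simp add: f_def u_def power_mult_distrib exp_minus field_simps)
  qed
  ultimately have "(\<lambda>n. (1 / ?r n) ^ Suc n * u n) \<longlonglongrightarrow> 1 / exp (- (complex_of_real t)\<^sup>2 * s)"
    by simp
  from tendsto_add[OF err this]
  have "(\<lambda>n. ?T n * u n) \<longlonglongrightarrow> 1 / exp (- (complex_of_real t)\<^sup>2 * s)"
    by (simp add: algebra_simps)
  also have "1 / exp (- (complex_of_real t)\<^sup>2 * s) = exp (- complex_of_real ((2 + 2 * exp 1 - (exp 1)\<^sup>2) * t\<^sup>2 / 2))"
  proof -
    have "- (complex_of_real t)\<^sup>2 * s = complex_of_real ((2 + 2 * exp 1 - (exp 1)\<^sup>2) * t\<^sup>2 / 2)"
      by (simp add: s_def)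
    then show ?thesis by (simp only: exp_minus divide_inverse mult_1)
  qed
  finally show ?thesis by (simp add: u_def)
qed

text \<open>The expression is \<open>3 - (exp 1 - 1)\<^sup>2\<close>, and 1.72 squared is below
  3.\<close>

lemma descent_variance_pos: "2 + 2 * exp 1 - (exp 1)\<^sup>2 > (0::real)"
proof -
  have "(exp 1 - 1 :: real)\<^sup>2 < (172/100)\<^sup>2"
    using e_less_272 by (intro power_strict_mono) auto
  then show ?thesis by (simp add: power2_eq_square algebra_simps)
qed

text \<open>By Levy's continuity theorem pointwise convergence of characteristic functions suffices;
  at \<open>t = 0\<close> all of them equal 1.\<close>

theorem corollary1p4:
  shows "weak_conv_m
    (\<lambda>n::nat. distr (measure_pmf (pmf_of_set (permutations_of_set {1..n}))) borel
       (\<lambda>\<pi>. (real (des (stack_sort \<pi>)) + 1 - (3 - exp 1) * real n) / sqrt (real n)))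
    (density lborel (normal_density 0 (sqrt (2 + 2 * exp 1 - (exp 1)\<^sup>2))))"
proof (rule levy_continuity)
  let ?v = "2 + 2 * exp 1 - (exp 1)\<^sup>2 :: real"
  let ?M = "\<lambda>n::nat. distr (measure_pmf (pmf_of_set (permutations_of_set {1..n}))) borel
       (\<lambda>\<pi>. (real (des (stack_sort \<pi>)) + 1 - (3 - exp 1) * real n) / sqrt (real n))"
  let ?N = "density lborel (normal_density 0 (sqrt ?v))"
  show M: "real_distribution (?M n)" for n
    by (rule prob_space.real_distribution_distr[OF measure_pmf.prob_space_axioms]) simp
  show N: "real_distribution ?N"
    by (rule char_normal_distribution) (use descent_variance_pos in simp)
  show "(\<lambda>n. char (?M n) t) \<longlonglongrightarrow> char ?N t" for t
  proof (cases "t = 0")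
    case True
    then show ?thesis
      using real_distribution.char_zero[OF M] real_distribution.char_zero[OF N] by simp
  next
    case False
    have "char ?N t = exp (- complex_of_real (?v * t\<^sup>2 / 2))"
    proof -
      have "(sqrt ?v * t)\<^sup>2 = ?v * t\<^sup>2" using descent_variance_pos by (simp add: power_mult_distrib)
      moreover have "char ?N t = complex_of_real (exp (- (sqrt ?v * t)\<^sup>2 / 2))"
        by (rule char_normal_distribution) (use descent_variance_pos in simp)
      ultimately show ?thesis
        by (simp only: exp_of_real[symmetric] of_real_minus[symmetric] minus_divide_left)
    qed
    then show ?thesis
      using char_normalized_descents_tendsto[OF False] unfolding char_normalized_descents by (simp only:)
  qed
qed

end
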